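(* Let $p\in(0,1)$, let $K\in\mathbb{N}$, and let $S_n^{(k)}=\sum_{m=1}^n\eta_{k,m}$ for $k\in\{-K,\ldots,K\}$ and $n\in\mathbb{N}$, where $(\eta_{k,n})_{k\in\mathbb{Z},n\in\mathbb{N}}$ is the array defined in the context. The following statements hold almost surely. \begin{enumerate} \item ($d=1$) If $p\neq 1/2$, then for every integer $k$ with $-K\le k\le 0$ the process $(S_n^{(k)})_n$ visits $0$ only finitely many times. For every integer $k$ with $1\le k\le K$, the process $(S_n^{(k)})_n$ visits $0$ infinitely often. \item ($d=2$) For all integers $k,\ell\in\{1,\ldots,K\}$, the two-dimensional process $\big((S_n^{(k)},S_n^{(\ell)})\big)_n$ visits the origin $(0,0)$ infinitely often. \item ($3\le d\leq K$) For any $d$ distinct indices $k_1,\ldots,k_d\in\{1,\ldots,K\}$, the $d$-dimensional process $\big((S_n^{(k_1)},\ldots,S_n^{(k_d)})\big)_n$ visits the origin only finitely many times. \end{enumerate}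
   Context: $\mathbb{N}=\{1,2,\ldots\}$. Let $(\xi_n)_{n\in\mathbb{N}}$ be i.i.d. random variables with $\mathbb{P}(\xi_n=1)=p$ and $\mathbb{P}(\xi_n=-1)=1-p$. The array $(\eta_{k,n})_{k\in\mathbb{Z},n\in\mathbb{N}}$ with values in $\{-1,1\}$ is defined, for $n\in\mathbb{N}$, by $$\eta_{0,n}=\xi_n,\qquad \eta_{k+1,n}=\prod_{m=1}^n\eta_{k,m}\ \ (k\ge 0),\qquad \eta_{-k,n}=\eta_{-k+1,n-1}\,\eta_{-k+1,n}\ \ (k\geq 1),$$ with the convention $\eta_{k,0}=1$ for all $k$ (so that $\eta_{k,1}=\xi_1$ for every $k\in\mathbb{Z}$). *)

theory Defs
  imports "HOL-Probability.Probability"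
begin

text \<open>The array is a deterministic function of the sample path \<open>x\<close> of \<open>(\<xi>\<^sub>n)\<close>; only the values
  \<open>x n\<close> with \<open>n \<ge> 1\<close> are used. The lemmas below restate the equation in the usual two-sided form.\<close>

function eta :: "(nat \<Rightarrow> int) \<Rightarrow> int \<Rightarrow> nat \<Rightarrow> int" where
  "eta x k n =
    (if n = 0 then 1
     else if k = 0 then x n
     else if k > 0 then (\<Prod>m = 1..n. eta x (k - 1) m)
     else eta x (k + 1) (n - 1) * eta x (k + 1) n)"
  by auto
termination
  by (relation "Wellfounded.measure (\<lambda>(x, k, n). nat \<bar>k\<bar>)") auto

declare eta.simps [simp del]

lemma eta_at_0 [simp]: "eta x k 0 = 1"
  by (subst eta.simps) simp

lemma eta_zero: "n \<ge> 1 \<Longrightarrow> eta x 0 n = x n"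
  by (subst eta.simps) simp

lemma eta_up: "k \<ge> 0 \<Longrightarrow> eta x (k + 1) n = (\<Prod>m = 1..n. eta x k m)"
  by (subst eta.simps) simp

lemma eta_down:
  "k \<ge> 1 \<Longrightarrow> n \<ge> 1 \<Longrightarrow> eta x (- k) n = eta x (- k + 1) (n - 1) * eta x (- k + 1) n"
  by (subst eta.simps) simp

lemma eta_at_1: "eta x k 1 = x 1"
proof (induction "nat \<bar>k\<bar>" arbitrary: k)
  case 0
  then show ?case by (simp add: eta_zero)
next
  case (Suc j)
  show ?case
  proof (cases "k > 0")
    case True
    then have "eta x (k - 1) 1 = x 1" using Suc by simp
    with True show ?thesis by (subst eta.simps) simp
  next
    case False
    then have "eta x (k + 1) 1 = x 1" using Suc by simp
    with False Suc.hyps(2) show ?thesis by (subst eta.simps) simp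
  qed
qed

definition S :: "(nat \<Rightarrow> int) \<Rightarrow> int \<Rightarrow> nat \<Rightarrow> int" where
  "S x k n = (\<Sum>m = 1..n. eta x k m)"

end

theory Submission
  imports Defs
begin

text \<open>
The levels \<open>1, \<dots>, K\<close> of the array, observed at time \<open>n\<close>, form a Markov chain on \<open>{1, -1} ^ K\<close> driven by
the signs \<open>\<xi>\<close>, and the partial sums are additive functionals of this chain. Instead of a local
limit theorem for such functionals, the proof uses a \<^emph>\<open>switching\<close> argument. In a block of fixed length
there are, with a probability bounded from below, special words that come in equally likely
families: the words of a family are rearrangements of each other, lead to the same state, and
their effects on the chosen partial sums differ by fixed offsets. Conditionally on everything except the
choice within the families, the partial sums are a constant plus a sum of many independent fair signs
(\<open>switching_identity\<close>), for which sharp bounds follow from binomial coefficients.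

\<^item> For three levels \<open>a < b < c\<close> there are switches of the highest level that leave all lower sums
unchanged (\<open>one_coordinate_switching\<close>): reading the word that flips level \<open>c\<close> one step earlier or
later. So each further level costs a factor of order \<open>1 / sqrt n\<close>, the probability that all three sums
vanish is of order at most \<open>n powr (-3/2)\<close>, and the Borel-Cantelli lemma applies
(\<open>zero_prob_three_summable\<close>).

\<^item> For two levels \<open>k < l\<close> there are special words that switch both sums independently
(\<open>two_coordinate_switching\<close>). Together with second moments of order \<open>n\<close> they show that along the
multiples of a fixed \<open>L\<close> the probability of a simultaneous zero, at a time when all levels up to \<open>l\<close> are
\<open>1\<close>, is at least of order \<open>1 / n\<close> (\<open>return_probability_lower_bound\<close>). This event
is regenerative and has infinite expected number of occurrences, so decomposing with respect to its
last occurrence shows that almost surely there is no last one (\<open>AE_infinitely_often\<close>). The case of one level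
is contained in this one.

\<^item> For levels \<open>- j \<le> 0\<close> the entries are, from index \<open>j + 1\<close> on, monomials in the last \<open>j + 1\<close> signs, with a
common expectation that is nonzero for \<open>p \<noteq> 1/2\<close>. The variance of the partial sums grows linearly, and
Chebyshev's inequality along the squares shows that zeros eventually stop
(\<open>near_zero_at_squares_summable\<close>).
\<close>

section \<open>Sign words and their weights\<close>

definition words :: "nat \<Rightarrow> int list set" where
  "words n = {u. length u = n \<and> set u \<subseteq> {1, -1}}"

lemma finite_words [simp]: "finite (words n)"
  using finite_lists_length_eq[of "{1, -1::int}" n] by (simp add: words_def conj_commute)

lemma words_0 [simp]: "words 0 = {[]}"
  by (auto simp: words_def)

lemma words_Suc: "words (Suc n) = (#) 1 ` words n \<union> (#) (-1) ` words n"
  by (auto simp: words_def length_Suc_conv image_iff)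

lemma append_words: "u \<in> words m \<Longrightarrow> w \<in> words n \<Longrightarrow> u @ w \<in> words (m + n)"
  by (auto simp: words_def)

lemma replicate_words: "replicate n 1 \<in> words n"
  by (auto simp: words_def)

locale coin =
  fixes p :: real
  assumes p_pos: "0 < p" and p_less_1: "p < 1"
begin

definition wt :: "int list \<Rightarrow> real" where
  "wt u = prod_list (map (\<lambda>b. if b = 1 then p else 1 - p) u)"

text \<open>The expectation of a function of the first \<open>n\<close> signs, as a finite sum. All estimates are made
for \<open>Ew\<close>, where independence is just \<open>Ew_append\<close>; the measure space enters only at the end.\<close>

definition Ew :: "nat \<Rightarrow> (int list \<Rightarrow> real) \<Rightarrow> real" where
  "Ew n g = (\<Sum>u\<in>words n. wt u * g u)"

lemma wt_Nil [simp]: "wt [] = 1"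
  and wt_Cons [simp]: "wt (b # u) = (if b = 1 then p else 1 - p) * wt u"
  by (simp_all add: wt_def)

lemma wt_pos: "0 < wt u"
  using p_pos p_less_1 by (induction u) auto

lemma wt_nonneg [simp]: "0 \<le> wt u"
  using wt_pos[of u] by simp

text \<open>Words that are rearrangements of each other are equally likely, whatever \<open>p\<close> is. Every pair of
words that is exchanged below is of this kind.\<close>

lemma wt_mset: "mset u = mset w \<Longrightarrow> wt u = wt w"
  unfolding wt_def by (metis mset_map prod_mset_prod_list)

lemma wt_ge: "min p (1 - p) ^ length u \<le> wt u"
proof (induction u)
  case (Cons b u)
  have "min p (1 - p) * min p (1 - p) ^ length u \<le> (if b = 1 then p else 1 - p) * wt u"
    by (rule mult_mono) (use p_pos p_less_1 Cons in auto)
  then show ?case by simp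
qed simp

lemma Ew_0 [simp]: "Ew 0 g = g []"
  by (simp add: Ew_def)

lemma Ew_Suc: "Ew (Suc n) g = p * Ew n (\<lambda>u. g (1 # u)) + (1 - p) * Ew n (\<lambda>u. g (-1 # u))"
proof -
  have "Ew (Suc n) g = (\<Sum>u\<in>(#) 1 ` words n. wt u * g u) + (\<Sum>u\<in>(#) (-1) ` words n. wt u * g u)"
    unfolding Ew_def words_Suc by (rule sum.union_disjoint) auto
  then show ?thesis
    by (simp add: sum.reindex Ew_def sum_distrib_left mult.assoc)
qed

lemma Ew_append: "Ew (m + n) g = Ew m (\<lambda>u. Ew n (\<lambda>w. g (u @ w)))"
  by (induction m arbitrary: g) (simp_all add: Ew_Suc)

lemma Ew_add: "Ew n (\<lambda>u. f u + g u) = Ew n f + Ew n g"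
  by (simp add: Ew_def algebra_simps sum.distrib)

lemma Ew_diff: "Ew n (\<lambda>u. f u - g u) = Ew n f - Ew n g"
  by (simp add: Ew_def algebra_simps sum_subtractf)

lemma Ew_cmult: "Ew n (\<lambda>u. c * f u) = c * Ew n f"
  by (simp add: Ew_def algebra_simps sum_distrib_left)

lemma Ew_sum: "Ew n (\<lambda>u. \<Sum>i\<in>A. f i u) = (\<Sum>i\<in>A. Ew n (f i))"
  unfolding Ew_def sum_distrib_left by (rule sum.swap)

lemma Ew_const [simp]: "Ew n (\<lambda>_. c) = c"
  by (induction n) (simp_all add: Ew_Suc algebra_simps)

lemma sum_wt: "(\<Sum>u\<in>words n. wt u) = 1"
  using Ew_const[of n 1] unfolding Ew_def by simp

lemma Ew_mono: "(\<And>u. u \<in> words n \<Longrightarrow> f u \<le> g u) \<Longrightarrow> Ew n f \<le> Ew n g"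
  unfolding Ew_def by (intro sum_mono mult_left_mono) auto

lemma Ew_cong: "(\<And>u. u \<in> words n \<Longrightarrow> f u = g u) \<Longrightarrow> Ew n f = Ew n g"
  unfolding Ew_def by (intro sum.cong) auto

lemma Ew_nonneg: "(\<And>u. u \<in> words n \<Longrightarrow> 0 \<le> f u) \<Longrightarrow> 0 \<le> Ew n f"
  unfolding Ew_def by (intro sum_nonneg mult_nonneg_nonneg) auto

lemma Ew_abs_le: "(\<And>u. u \<in> words n \<Longrightarrow> \<bar>f u\<bar> \<le> c) \<Longrightarrow> \<bar>Ew n f\<bar> \<le> c"
  using Ew_mono[of n f "\<lambda>_. c"] Ew_mono[of n "\<lambda>_. - c" f] by (auto simp: abs_le_iff minus_le_iff)

lemma Ew_split:
  assumes "A \<subseteq> words n"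
  shows "Ew n g = (\<Sum>u\<in>A. wt u * g u) + (\<Sum>u\<in>words n - A. wt u * g u)"
  unfolding Ew_def using sum.subset_diff[OF assms, of "\<lambda>u. wt u * g u"] by simp

end

section \<open>Switching identity\<close>

text \<open>A path is cut into blocks of length \<open>L\<close>. Reading a block \<open>u\<close> in state \<open>x\<close> leads to the state
\<open>R x u\<close> and adds \<open>D x u\<close> to the vector of partial sums. In each state there is a family of
equally likely special blocks \<open>sp x o\<close> that all lead to the same state, and whose increments
differ only by the offsets \<open>o\<close> around a common centre \<open>c x\<close>. Given everything but the choice
among the special blocks of one family, the offsets are therefore independent and uniform.\<close>

locale switching = coin +
  fixes L :: nat and R :: "'s \<Rightarrow> int list \<Rightarrow> 's" and D :: "'s \<Rightarrow> int list \<Rightarrow> nat \<Rightarrow> int"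
    and X :: "'s set" and Off :: "(nat \<Rightarrow> int) set"
    and sp :: "'s \<Rightarrow> (nat \<Rightarrow> int) \<Rightarrow> int list" and z :: "'s \<Rightarrow> 's" and c :: "'s \<Rightarrow> nat \<Rightarrow> int"
    and q :: real
  assumes R_in: "x \<in> X \<Longrightarrow> u \<in> words L \<Longrightarrow> R x u \<in> X"
    and Off_fin: "finite Off" and Off_ne: "Off \<noteq> {}"
    and sp_words: "x \<in> X \<Longrightarrow> o1 \<in> Off \<Longrightarrow> sp x o1 \<in> words L"
    and sp_mset: "x \<in> X \<Longrightarrow> o1 \<in> Off \<Longrightarrow> o2 \<in> Off \<Longrightarrow> mset (sp x o1) = mset (sp x o2)"
    and sp_R: "x \<in> X \<Longrightarrow> o1 \<in> Off \<Longrightarrow> R x (sp x o1) = z x"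
    and sp_D: "x \<in> X \<Longrightarrow> o1 \<in> Off \<Longrightarrow> D x (sp x o1) = (\<lambda>j. c x j + o1 j)"
    and q_le: "x \<in> X \<Longrightarrow> o1 \<in> Off \<Longrightarrow> q \<le> wt (sp x o1)" and q_pos: "0 < q"
begin

text \<open>\<open>T\<close> is the transition operator of state and sums over one block. \<open>Tc\<close> below is the one of the
centred process, which puts the centre in place of the increment of a special block and counts the
special blocks in a third coordinate; \<open>Av\<close> averages over one offset.\<close>

definition T :: "('s \<Rightarrow> (nat \<Rightarrow> int) \<Rightarrow> real) \<Rightarrow> 's \<Rightarrow> (nat \<Rightarrow> int) \<Rightarrow> real" where
  "T g x v = Ew L (\<lambda>u. g (R x u) (\<lambda>j. v j + D x u j))"

definition spec :: "'s \<Rightarrow> int list set" where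
  "spec x = sp x ` Off"

definition Dc :: "'s \<Rightarrow> int list \<Rightarrow> nat \<Rightarrow> int" where
  "Dc x u = (if u \<in> spec x then c x else D x u)"

definition Tc :: "('s \<Rightarrow> (nat \<Rightarrow> int) \<Rightarrow> nat \<Rightarrow> real) \<Rightarrow> 's \<Rightarrow> (nat \<Rightarrow> int) \<Rightarrow> nat \<Rightarrow> real" where
  "Tc G x v m = Ew L (\<lambda>u. G (R x u) (\<lambda>j. v j + Dc x u j) (if u \<in> spec x then Suc m else m))"

definition Av :: "('s \<Rightarrow> (nat \<Rightarrow> int) \<Rightarrow> real) \<Rightarrow> 's \<Rightarrow> (nat \<Rightarrow> int) \<Rightarrow> real" where
  "Av g x v = (\<Sum>o1\<in>Off. g x (\<lambda>j. v j + o1 j)) / card Off"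

lemma card_Off: "0 < card Off"
  using Off_fin Off_ne by (simp add: card_gt_0_iff)

lemma sp_inj: "x \<in> X \<Longrightarrow> inj_on (sp x) Off"
proof (rule inj_onI)
  fix o1 o2 assume *: "x \<in> X" "o1 \<in> Off" "o2 \<in> Off" "sp x o1 = sp x o2"
  then have "(\<lambda>j. c x j + o1 j) = (\<lambda>j. c x j + o2 j)" using sp_D by metis
  then show "o1 = o2" by (metis add_left_cancel ext)
qed

lemma spec_words: "x \<in> X \<Longrightarrow> spec x \<subseteq> words L"
  using sp_words by (auto simp: spec_def)

lemma T_Av_comm: "T (Av g) = Av (T g)"
proof (intro ext)
  fix x v
  have "T (Av g) x v = Ew L (\<lambda>u. \<Sum>o1\<in>Off. (1 / card Off) * g (R x u) (\<lambda>j. v j + D x u j + o1 j))"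
    unfolding T_def Av_def by (simp add: sum_divide_distrib)
  also have "\<dots> = (\<Sum>o1\<in>Off. (1 / card Off) * Ew L (\<lambda>u. g (R x u) (\<lambda>j. v j + D x u j + o1 j)))"
    by (simp only: Ew_sum Ew_cmult)
  also have "\<dots> = Av (T g) x v"
    unfolding T_def Av_def by (simp add: sum_divide_distrib algebra_simps)
  finally show "T (Av g) x v = Av (T g) x v" .
qed

lemma T_Avpow_comm: "T ((Av ^^ m) g) = (Av ^^ m) (T g)"
  by (induction m) (simp_all add: T_Av_comm)

lemma T_eq_Tc:
  assumes "x \<in> X"
  shows "(Av ^^ m) (T g) x v = Tc (\<lambda>x v m. (Av ^^ m) g x v) x v m"
proof -
  let ?f = "(Av ^^ m) g"
  (* All special blocks of the family have the same weight w and the same final state, so their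
     contribution is an average over the offsets. *)
  obtain o0 where o0: "o0 \<in> Off" using Off_ne by blast
  define w where "w = wt (sp x o0)"
  have w: "wt (sp x o1) = w" if "o1 \<in> Off" for o1
    unfolding w_def using sp_mset[OF assms that o0] by (rule wt_mset)
  have inj: "inj_on (sp x) Off" by (rule sp_inj) fact
  have "(\<Sum>u\<in>spec x. wt u * ?f (R x u) (\<lambda>j. v j + D x u j))
      = (\<Sum>o1\<in>Off. w * ?f (z x) (\<lambda>j. v j + c x j + o1 j))"
    unfolding spec_def using inj sp_R sp_D w assms by (simp add: sum.reindex algebra_simps)
  also have "\<dots> = w * (card Off * Av ?f (z x) (\<lambda>j. v j + c x j))"
    using card_Off by (simp add: Av_def[of ?f] sum_distrib_left[symmetric])
  also have "\<dots> = (\<Sum>o1\<in>Off. w * Av ?f (z x) (\<lambda>j. v j + c x j))"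
    by simp
  also have "\<dots> = (\<Sum>u\<in>spec x. wt u * Av ?f (R x u) (\<lambda>j. v j + c x j))"
    unfolding spec_def using inj sp_R w assms by (simp add: sum.reindex)
  finally have *: "(\<Sum>u\<in>spec x. wt u * ?f (R x u) (\<lambda>j. v j + D x u j))
      = (\<Sum>u\<in>spec x. wt u * Av ?f (R x u) (\<lambda>j. v j + c x j))" .
  have "(Av ^^ m) (T g) x v = T ?f x v" by (simp add: T_Avpow_comm)
  also have "\<dots> = Tc (\<lambda>x v m. (Av ^^ m) g x v) x v m"
    using * by (simp add: T_def[of ?f] Tc_def Ew_split[OF spec_words[OF assms]] Dc_def)
  finally show ?thesis .
qed

lemma Tc_cong:
  assumes "\<And>x v m. x \<in> X \<Longrightarrow> G x v m = H x v m" "x \<in> X"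
  shows "Tc G x v m = Tc H x v m"
  unfolding Tc_def using assms R_in by (intro Ew_cong) auto

lemma Tc_mono:
  assumes "\<And>u. u \<in> words L \<Longrightarrow>
      G (R x u) (\<lambda>j. v j + Dc x u j) (if u \<in> spec x then Suc m else m)
      \<le> H (R x u) (\<lambda>j. v j + Dc x u j) (if u \<in> spec x then Suc m else m)"
  shows "Tc G x v m \<le> Tc H x v m"
  unfolding Tc_def using assms by (rule Ew_mono)

text \<open>Conditioning on everything but the offsets, in operator form: the averages commute with \<open>T\<close>
because they only translate the sums, so the average produced by a special block can be pulled
through all remaining blocks.\<close>

lemma switching_identity:
  "x \<in> X \<Longrightarrow> (Av ^^ m) ((T ^^ N) g) x v = (Tc ^^ N) (\<lambda>x v m. (Av ^^ m) g x v) x v m"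
proof (induction N arbitrary: x v m)
  case (Suc N)
  have "(Av ^^ m) ((T ^^ Suc N) g) x v = Tc (\<lambda>x v m. (Av ^^ m) ((T ^^ N) g) x v) x v m"
    using T_eq_Tc[OF Suc.prems, of m "(T ^^ N) g"] by simp
  also have "\<dots> = (Tc ^^ Suc N) (\<lambda>x v m. (Av ^^ m) g x v) x v m"
    using Tc_cong[OF _ Suc.prems, of "\<lambda>x v m. (Av ^^ m) ((T ^^ N) g) x v"
        "(Tc ^^ N) (\<lambda>x v m. (Av ^^ m) g x v)"] Suc.IH by simp
  finally show ?case .
qed simp

lemma T_pow_eq:
  "x \<in> X \<Longrightarrow> (T ^^ N) g x v = (Tc ^^ N) (\<lambda>x v m. (Av ^^ m) g x v) x v 0"
  using switching_identity[of x 0 N g v] by simp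

text \<open>An invariant of the centred process restricts the comparison of two functions to the states that
can occur. Its first argument counts the remaining blocks, so that it can also bound the number of
special blocks.\<close>

lemma Tc_pow_mono:
  assumes step: "\<And>i x v m u. Inv (Suc i) x v m \<Longrightarrow> x \<in> X \<Longrightarrow> u \<in> words L \<Longrightarrow>
      Inv i (R x u) (\<lambda>j. v j + Dc x u j) (if u \<in> spec x then Suc m else m)"
    and le: "\<And>x v m. Inv 0 x v m \<Longrightarrow> x \<in> X \<Longrightarrow> G x v m \<le> H x v m"
  shows "Inv N x v m \<Longrightarrow> x \<in> X \<Longrightarrow> (Tc ^^ N) G x v m \<le> (Tc ^^ N) H x v m"
proof (induction N arbitrary: x v m)
  case 0 then show ?case by (simp add: le)
next
  case (Suc N)
  then show ?case
    by (simp only: funpow.simps comp_apply, intro Tc_mono Suc.IH step R_in)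
qed

lemma Tc_pow_mono':
  assumes "\<And>x v m. x \<in> X \<Longrightarrow> G x v m \<le> H x v m" "x \<in> X"
  shows "(Tc ^^ N) G x v m \<le> (Tc ^^ N) H x v m"
  by (rule Tc_pow_mono[where Inv = "\<lambda>_ _ _ _. True"]) (use assms in auto)

lemma Tc_pow_add:
  "(Tc ^^ N) (\<lambda>x v m. G x v m + H x v m) x v m = (Tc ^^ N) G x v m + (Tc ^^ N) H x v m"
proof (induction N arbitrary: x v m)
  case (Suc N)
  then show ?case by (simp add: Tc_def Ew_add)
qed simp

lemma Tc_pow_cmult:
  "(Tc ^^ N) (\<lambda>x v m. a * G x v m) x v m = a * (Tc ^^ N) G x v m"
proof (induction N arbitrary: x v m)
  case (Suc N)
  then show ?case by (simp add: Tc_def Ew_cmult)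
qed simp

lemma spec_wt: assumes "x \<in> X" shows "q \<le> (\<Sum>u\<in>spec x. wt u)"
proof -
  obtain o0 where o0: "o0 \<in> Off" using Off_ne by blast
  have "finite (spec x)" using Off_fin by (simp add: spec_def)
  moreover have "sp x o0 \<in> spec x" using o0 by (simp add: spec_def)
  ultimately have "wt (sp x o0) \<le> (\<Sum>u\<in>spec x. wt u)"
    by (intro member_le_sum) auto
  then show ?thesis using q_le[OF assms o0] by simp
qed

lemma q_le_1: assumes "x \<in> X" shows "q \<le> 1"
proof -
  have "(\<Sum>u\<in>spec x. wt u) \<le> (\<Sum>u\<in>words L. wt u)"
    by (rule sum_mono2) (use spec_words[OF assms] in auto)
  then show ?thesis using spec_wt[OF assms] sum_wt by simp
qed

text \<open>Each block is special with probability at least \<open>q\<close>, whatever happened before, and then halves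
the value of \<open>(1/2) ^ m\<close>.\<close>

lemma few_special_blocks:
  assumes "x \<in> X"
  shows "(Tc ^^ N) (\<lambda>x v m. (1/2) ^ m) x v m \<le> (1 - q / 2) ^ N * (1/2) ^ m"
  using assms
proof (induction N arbitrary: x v m)
  case (Suc N)
  have "(Tc ^^ Suc N) (\<lambda>x v m. (1/2) ^ m) x v m
      \<le> Ew L (\<lambda>u. (1 - q / 2) ^ N * (1/2) ^ (if u \<in> spec x then Suc m else m))"
    unfolding funpow.simps comp_apply Tc_def[of "(Tc ^^ N) _"] by (intro Ew_mono Suc.IH R_in Suc.prems)
  also have "\<dots> = (1 - q / 2) ^ N * (1/2) ^ m * Ew L (\<lambda>u. (if u \<in> spec x then 1/2 else 1))"
    by (subst Ew_cmult[symmetric], intro Ew_cong) auto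
  also have "Ew L (\<lambda>u. (if u \<in> spec x then 1/2 else 1)) = 1 - (\<Sum>u\<in>spec x. wt u) / 2"
  proof -
    have "(\<Sum>u\<in>spec x. wt u) + (\<Sum>u\<in>words L - spec x. wt u) = 1"
      using Ew_split[OF spec_words[OF Suc.prems], of "\<lambda>_. 1"] by simp
    then show ?thesis
      unfolding Ew_split[OF spec_words[OF Suc.prems]] by (simp add: sum_divide_distrib[symmetric])
  qed
  also have "(1 - q / 2) ^ N * (1/2) ^ m * (1 - (\<Sum>u\<in>spec x. wt u) / 2)
      \<le> (1 - q / 2) ^ N * (1/2) ^ m * (1 - q / 2)"
    using spec_wt[OF Suc.prems] q_le_1[OF Suc.prems] by (intro mult_left_mono) auto
  finally show ?case by (simp add: mult_ac)
qed simp

end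

section \<open>The chain of levels\<close>

text \<open>A state lists the current values of the levels \<open>1, \<dots>, K\<close>; all other entries are kept at \<open>1\<close>, so
that equality of functions is equality of states. Since \<open>\<eta>\<close> satisfies
\<open>\<eta>(k+1, n+1) = \<eta>(k+1, n) * \<eta>(k, n+1)\<close>, a new sign \<open>b\<close> multiplies the product of the old levels
\<open>1, \<dots>, j\<close> to give the new level \<open>j\<close>.\<close>

definition step :: "nat \<Rightarrow> (nat \<Rightarrow> int) \<Rightarrow> int \<Rightarrow> nat \<Rightarrow> int" where
  "step K x b = (\<lambda>j. if j \<in> {1..K} then b * (\<Prod>i=1..j. x i) else 1)"

definition run :: "nat \<Rightarrow> (nat \<Rightarrow> int) \<Rightarrow> int list \<Rightarrow> nat \<Rightarrow> int" where
  "run K x u = foldl (step K) x u"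

text \<open>The increment of the partial sum of level \<open>j\<close> while a word is read.\<close>

primrec ssum :: "nat \<Rightarrow> nat \<Rightarrow> (nat \<Rightarrow> int) \<Rightarrow> int list \<Rightarrow> int" where
  "ssum K j x [] = 0"
| "ssum K j x (b # u) = step K x b j + ssum K j (step K x b) u"

definition states :: "nat \<Rightarrow> (nat \<Rightarrow> int) set" where
  "states K = {x. (\<forall>j. x j \<in> {1, -1}) \<and> (\<forall>j. j \<notin> {1..K} \<longrightarrow> x j = 1)}"

abbreviation one :: "nat \<Rightarrow> int" where "one \<equiv> (\<lambda>_. 1)"

lemma run_Nil [simp]: "run K x [] = x"
  and run_Cons [simp]: "run K x (b # u) = run K (step K x b) u"
  and run_append: "run K x (u @ w) = run K (run K x u) w"
  by (simp_all add: run_def)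

lemma ssum_append: "ssum K j x (u @ w) = ssum K j x u + ssum K j (run K x u) w"
  by (induction u arbitrary: x) auto

lemma sign_mult: "a \<in> {1, -1} \<Longrightarrow> b \<in> {1, -1} \<Longrightarrow> a * b \<in> {1, -1::int}"
  by auto

lemma sign_prod:
  fixes f :: "'i \<Rightarrow> int"
  shows "(\<And>i. i \<in> A \<Longrightarrow> f i \<in> {1, -1}) \<Longrightarrow> (\<Prod>i\<in>A. f i) \<in> {1, -1}"
proof (induction A rule: infinite_finite_induct)
  case (insert a A)
  then show ?case using sign_mult[of "f a" "prod f A"] by simp
qed auto

lemma sign_square: "(a::int) \<in> {1, -1} \<Longrightarrow> a * a = 1"
  by auto

lemma states_sign: "x \<in> states K \<Longrightarrow> x j \<in> {1, -1}"
  by (simp add: states_def)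

lemma one_states [simp]: "one \<in> states K"
  by (simp add: states_def)

lemma step_states:
  assumes "x \<in> states K" "b \<in> {1, -1}"
  shows "step K x b \<in> states K"
  unfolding states_def step_def
  using assms sign_mult[OF assms(2) sign_prod[of "{1.._}" x]] states_sign[OF assms(1)] by auto

lemma run_states: "x \<in> states K \<Longrightarrow> u \<in> words n \<Longrightarrow> run K x u \<in> states K"
  by (induction u arbitrary: x n) (auto simp: words_def step_states)

lemma step_mult:
  "step K (\<lambda>i. x i * y i) (b * b') = (\<lambda>j. step K x b j * step K y b' j)"
  by (auto simp: step_def prod.distrib)

text \<open>In additive notation the chain is affine over the field with two elements: the difference of two
paths driven by the same word is the path of the difference driven by the word of ones.\<close>

lemma run_mult:
  "run K (\<lambda>i. x i * y i) u = (\<lambda>j. run K x u j * run K y (replicate (length u) 1) j)"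
proof (induction u arbitrary: x y)
  case (Cons b u)
  then show ?case using step_mult[of K x y b 1] by simp
qed simp

lemma step_one [simp]: "step K one 1 = one"
  by (auto simp: step_def)

lemma run_one_ones [simp]: "run K one (replicate n 1) = one"
  by (induction n) auto

lemma step_top [simp]: assumes "1 \<le> K" shows "step K (one(K := y)) 1 = one(K := y)"
proof
  fix j
  show "step K (one(K := y)) 1 j = (one(K := y)) j"
  proof (cases "j = K")
    case True
    have "(\<Prod>i=1..K. (one(K := y)) i) = y"
      using assms by (simp add: prod.remove[of "{1..K}" K])
    with True assms show ?thesis by (simp add: step_def)
  next
    case False
    then show ?thesis by (auto simp: step_def intro!: prod.neutral)
  qed
qed

lemma run_top_ones [simp]: "1 \<le> K \<Longrightarrow> run K (one(K := y)) (replicate n 1) = one(K := y)"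
  by (induction n) auto

lemma ssum_mult_fixed:
  assumes "step K y 1 = y"
  shows "ssum K j (\<lambda>i. x i * y i) u = y j * ssum K j x u"
proof (induction u arbitrary: x)
  case (Cons b u)
  then show ?case using step_mult[of K x y b 1] assms by (simp add: distrib_left)
qed simp

lemma ssum_ones_fixed: "step K y 1 = y \<Longrightarrow> ssum K j y (replicate n 1) = int n * y j"
  by (induction n) (auto simp: algebra_simps)

text \<open>The old levels can be recovered from the new ones, because the letter cancels in the product of two
consecutive levels. So the linear part of the chain is the inverse of identity plus shift, which is
where the period in the next lemmas comes from.\<close>

lemma step_prev:
  assumes "x \<in> states K" "b \<in> {1, -1}" "2 \<le> j" "j \<le> K"
  shows "x j = step K x b j * step K x b (j - 1)"
proof -
  have "b * (\<Prod>i=1..j - 1. x i) \<in> {1, -1}"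
    using assms states_sign[of x K] by (intro sign_mult sign_prod) auto
  moreover have "(\<Prod>i=1..j. x i) = x j * (\<Prod>i=1..j - 1. x i)"
    using prod.nat_ivl_Suc'[of 1 "j - 1" x] assms(3) by simp
  ultimately show ?thesis using assms(3,4) by (auto simp: step_def)
qed

text \<open>Over the field with two elements the \<open>2 ^ q\<close>-th power of identity plus shift is identity plus the
\<open>2 ^ q\<close>-fold shift. The induction doubles the number of ones and uses that signs square to \<open>1\<close>.\<close>

lemma run_ones_power2:
  assumes "x \<in> states K" "1 \<le> j" "j \<le> K"
  shows "run K x (replicate (2 ^ q) 1) j =
    x j * (if 2 ^ q < j then run K x (replicate (2 ^ q) 1) (j - 2 ^ q) else 1)"
  using assms
proof (induction q arbitrary: x j)
  case 0
  have s: "step K x 1 j \<in> {1, -1}" for j using step_states[of x K 1] 0 states_sign by auto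
  show ?case
  proof (cases "j = 1")
    case True then show ?thesis using 0 by (simp add: step_def)
  next
    case False
    then show ?thesis using step_prev[of x K 1 j] 0 s[of j] s[of "j - 1"] by auto
  qed
next
  case (Suc q)
  let ?m = "2 ^ q :: nat"
  define x' where "x' = run K x (replicate ?m 1)"
  define x'' where "x'' = run K x' (replicate ?m 1)"
  have x': "x' \<in> states K" unfolding x'_def by (rule run_states[OF Suc.prems(1) replicate_words])
  have x'': "x'' \<in> states K" unfolding x''_def by (rule run_states[OF x' replicate_words])
  have eq: "run K x (replicate (2 ^ Suc q) 1) = x''"
    by (simp add: x''_def x'_def run_append[symmetric] replicate_add[symmetric] mult_2)
  have i1: "x' j = x j * (if ?m < j then x' (j - ?m) else 1)" if "1 \<le> j" "j \<le> K" for j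
    using Suc.IH[OF Suc.prems(1) that] by (simp add: x'_def)
  have i2: "x'' j = x' j * (if ?m < j then x'' (j - ?m) else 1)" if "1 \<le> j" "j \<le> K" for j
    using Suc.IH[OF x' that] by (simp add: x''_def)
  show ?case
  proof (cases "?m < j")
    case False
    then show ?thesis using i1[of j] i2[of j] Suc.prems unfolding eq by simp
  next
    case True
    have "x'' j = x j * x' (j - ?m) * x'' (j - ?m)"
      using i1[of j] i2[of j] Suc.prems True by simp
    also have "x'' (j - ?m) = x' (j - ?m) * (if 2 ^ Suc q < j then x'' (j - 2 ^ Suc q) else 1)"
      using i2[of "j - ?m"] True Suc.prems by (auto simp: mult_2 less_diff_conv)
    finally show ?thesis
      unfolding eq using sign_square[OF states_sign[OF x', of "j - ?m"]] by (simp add: mult.assoc)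
  qed
qed

lemma run_ones_period:
  assumes "x \<in> states K" "K \<le> 2 ^ q"
  shows "run K x (replicate (2 ^ q) 1) = x"
proof
  fix j
  show "run K x (replicate (2 ^ q) 1) j = x j"
  proof (cases "j \<in> {1..K}")
    case True
    then show ?thesis using run_ones_power2[OF assms(1), of j q] assms(2) by simp
  next
    case False
    then show ?thesis
      using run_states[OF assms(1) replicate_words] assms(1) by (auto simp: states_def)
  qed
qed

lemma step_level:
  assumes "k \<le> l" "\<And>i. i \<in> {1..k} \<Longrightarrow> x i = y i" "j \<in> {1..k}"
  shows "step l x b j = step k y b j"
  using assms by (auto simp: step_def intro!: prod.cong)

lemma ssum_level:
  assumes "k \<le> l" "\<And>i. i \<in> {1..k} \<Longrightarrow> x i = y i" "j \<in> {1..k}"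
  shows "ssum l j x u = ssum k j y u"
  using assms(2)
proof (induction u arbitrary: x y)
  case (Cons b u)
  have "ssum l j (step l x b) u = ssum k j (step k y b) u"
    by (rule Cons.IH) (use step_level[OF assms(1) Cons.prems] in auto)
  then show ?case using step_level[OF assms(1) Cons.prems assms(3)] by simp
qed auto

text \<open>The top level can be prescribed: choosing the letter as \<open>y\<close> times the product of all levels makes
the next value of level \<open>K\<close> equal to \<open>y\<close>. This word does so \<open>n\<close> times in a row.\<close>

primrec steer :: "nat \<Rightarrow> int \<Rightarrow> nat \<Rightarrow> (nat \<Rightarrow> int) \<Rightarrow> int list" where
  "steer K y 0 x = []"
| "steer K y (Suc n) x = (y * (\<Prod>i=1..K. x i)) # steer K y n (step K x (y * (\<Prod>i=1..K. x i)))"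

lemma steer_words:
  assumes "x \<in> states K" "y \<in> {1, -1}"
  shows "steer K y n x \<in> words n"
  using assms(1)
proof (induction n arbitrary: x)
  case (Suc n)
  have "y * (\<Prod>i=1..K. x i) \<in> {1, -1}"
    using assms(2) states_sign[OF Suc.prems] by (intro sign_mult sign_prod) auto
  then show ?case using Suc.IH[OF step_states[OF Suc.prems]] by (auto simp: words_def)
qed simp

lemma step_steer:
  assumes "x \<in> states K" "1 \<le> j" "j \<le> K"
  shows "step K x (y * (\<Prod>i=1..K. x i)) j = y * (\<Prod>i=Suc j..K. x i)"
proof -
  have "{1..K} = {1..j} \<union> {Suc j..K}" "{1..j} \<inter> {Suc j..K} = {}" using assms by auto
  then have "(\<Prod>i=1..K. x i) = (\<Prod>i=1..j. x i) * (\<Prod>i=Suc j..K. x i)"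
    by (metis prod.union_disjoint finite_atLeastAtMost)
  moreover have "(\<Prod>i=1..j. x i) * (\<Prod>i=1..j. x i) = 1"
    using states_sign[OF assms(1)] by (intro sign_square sign_prod) auto
  ultimately show ?thesis using assms by (simp add: step_def algebra_simps)
qed

text \<open>If level \<open>K\<close> is constant, then level \<open>K - 1\<close>, the product of two consecutive values of level \<open>K\<close>,
is \<open>1\<close> from the second step on, level \<open>K - 2\<close> from the third, and so on.\<close>

lemma run_steer_partial:
  assumes "x \<in> states K" "y \<in> {1, -1}" "1 \<le> j" "j \<le> K" "K < j + n"
  shows "run K x (steer K y n x) j = (if j = K then y else 1)"
proof -
  (* The generalisation assumes that the initial state already agrees with the goal in the last m
     levels; m = 0 is the claim. *)
  have "x \<in> states K \<Longrightarrow> j \<le> K \<Longrightarrow> 1 \<le> j \<Longrightarrow> (\<And>i. j \<le> i \<Longrightarrow> i \<le> K \<Longrightarrow> K < i + m \<Longrightarrow> x i = (if i = K then y else 1))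
     \<Longrightarrow> K < j + m + n \<Longrightarrow> run K x (steer K y n x) j = (if j = K then y else 1)" for m
  proof (induction n arbitrary: x m)
    case 0
    then show ?case by simp
  next
    case (Suc n)
    let ?b = "y * (\<Prod>i=1..K. x i)"
    have b: "?b \<in> {1, -1}"
      using assms(2) states_sign[OF Suc.prems(1)] by (intro sign_mult sign_prod) auto
    have "run K (step K x ?b) (steer K y n (step K x ?b)) j = (if j = K then y else 1)"
    proof (rule Suc.IH[of _ "Suc m"])
      fix i assume i: "j \<le> i" "i \<le> K" "K < i + Suc m"
      have "step K x ?b i = y * (\<Prod>t=Suc i..K. x t)"
        using step_steer[OF Suc.prems(1), of i y] i Suc.prems(3) by simp
      also have "(\<Prod>t=Suc i..K. x t) = (if i = K then 1 else y)"
      proof (cases "i = K")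
        case False
        then have "(\<Prod>t=Suc i..K. x t) = (\<Prod>t=Suc i..K. if t = K then y else 1)"
          using Suc.prems(4) i by (intro prod.cong) auto
        then show ?thesis using False i by simp
      qed simp
      finally show "step K x ?b i = (if i = K then y else 1)" using assms(2) by auto
    qed (use Suc.prems step_states[OF Suc.prems(1) b] in auto)
    then show ?case by simp
  qed
  from this[of 0] show ?thesis using assms by simp
qed

lemma run_steer:
  assumes "x \<in> states K" "y \<in> {1, -1}" "1 \<le> K"
  shows "run K x (steer K y K x) = one(K := y)"
proof
  fix j
  have "run K x (steer K y K x) \<in> states K"
    using run_states[OF assms(1) steer_words[OF assms(1,2)]] .
  then show "run K x (steer K y K x) j = (one(K := y)) j"
    using run_steer_partial[OF assms(1,2), of j K] assms(3) by (cases "j \<in> {1..K}") (auto simp: states_def)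
qed

lemma ssum_steer:
  assumes "x \<in> states K" "y \<in> {1, -1}" "1 \<le> K"
  shows "ssum K K x (steer K y n x) = int n * y"
  using assms(1)
proof (induction n arbitrary: x)
  case (Suc n)
  let ?b = "y * (\<Prod>i=1..K. x i)"
  have b: "?b \<in> {1, -1}"
    using assms(2) states_sign[OF Suc.prems(1)] by (intro sign_mult sign_prod) auto
  show ?case
    using Suc.IH[OF step_states[OF Suc.prems b]] step_steer[OF Suc.prems, of K y] assms(3)
    by (simp add: algebra_simps)
qed simp

lemma ssum_bound:
  assumes "x \<in> states K" "u \<in> words n"
  shows "\<bar>ssum K j x u\<bar> \<le> int n"
  using assms
proof (induction u arbitrary: x n)
  case (Cons b u)
  then obtain n' where n: "n = Suc n'" "b \<in> {1, -1}" "u \<in> words n'" by (auto simp: words_def)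
  have "step K x b \<in> states K" using step_states Cons.prems n by blast
  then show ?case using Cons.IH[of "step K x b" n'] states_sign[of "step K x b" K j] n by auto
qed (simp add: words_def)

lemma ssum_parity:
  assumes "x \<in> states K" "u \<in> words n"
  shows "even (ssum K j x u + int n)"
  using assms
proof (induction u arbitrary: x n)
  case (Cons b u)
  then obtain n' where n: "n = Suc n'" "b \<in> {1, -1}" "u \<in> words n'" by (auto simp: words_def)
  have "step K x b \<in> states K" using step_states Cons.prems n by blast
  then show ?case using Cons.IH[of "step K x b" n'] states_sign[of "step K x b" K j] n by auto
qed (simp add: words_def)

text \<open>Level \<open>k + 1\<close> changes sign exactly when level \<open>k\<close> takes the value \<open>-1\<close>, so the sum of level \<open>k\<close>
modulo \<open>4\<close> is determined by the length and by the two end values of level \<open>k + 1\<close>.\<close>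

lemma ssum_mod4:
  assumes "x \<in> states K" "u \<in> words n" "1 \<le> k" "k < K"
  shows "4 dvd ssum K k x u - int n - x (Suc k) + run K x u (Suc k)"
  using assms(1,2)
proof (induction u arbitrary: x n)
  case (Cons b u)
  then obtain n' where n: "n = Suc n'" "b \<in> {1, -1}" "u \<in> words n'" by (auto simp: words_def)
  have s: "step K x b \<in> states K" using step_states Cons.prems n by blast
  have "step K x b (Suc k) = x (Suc k) * step K x b k"
    using assms(3,4) by (simp add: step_def)
  then have "4 dvd step K x b k - 1 - x (Suc k) + step K x b (Suc k)"
    using states_sign[OF s, of k] states_sign[OF Cons.prems(1), of "Suc k"] by auto
  from dvd_add[OF this Cons.IH[OF s n(3)]] show ?case using n by (simp add: algebra_simps)
qed (simp add: words_def)

lemma words_length: "u \<in> words n \<Longrightarrow> length u = n"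
  by (simp add: words_def)

lemma run_from_one: "run K x u = (\<lambda>i. run K one u i * run K x (replicate (length u) 1) i)"
  using run_mult[of K one x u] by simp

lemma states_square: "x \<in> states K \<Longrightarrow> x i * x i = 1"
  using states_sign sign_square by blast

lemma states_mult: "x \<in> states K \<Longrightarrow> y \<in> states K \<Longrightarrow> (\<lambda>i. x i * y i) \<in> states K"
  using sign_mult[of "x _" "y _"] by (auto simp: states_def simp del: insert_iff)

section \<open>Words that realise a switch\<close>

text \<open>Read when the levels below \<open>k\<close> are \<open>1\<close>, this word changes the sign of level \<open>k\<close> at its first
letter and leaves the levels below \<open>k\<close> equal to \<open>1\<close> at its end.\<close>

definition flip :: "nat \<Rightarrow> int list" where
  "flip k = steer k (-1) k one"

lemma flip_words: "flip k \<in> words k"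
  unfolding flip_def by (rule steer_words) auto

lemma run_flip: "1 \<le> k \<Longrightarrow> run k one (flip k) = one(k := -1)"
  unfolding flip_def by (rule run_steer) auto

lemma run_flip_back: assumes "1 \<le> k" shows "run k (one(k := -1)) (flip k) = one"
proof -
  have "run k (one(k := -1)) (flip k) = (\<lambda>i. (one(k := -1)) i * (one(k := -1)) i)"
    using run_from_one[of k "one(k := -1)" "flip k"] assms by (simp add: run_flip)
  then show ?thesis by auto
qed

lemma ssum_flip: "1 \<le> k \<Longrightarrow> ssum k k one (flip k) = - int k"
  unfolding flip_def by (subst ssum_steer) auto

lemma ssum_flip_back:
  "1 \<le> k \<Longrightarrow> ssum k j (one(k := -1)) (flip k) = (one(k := -1)) j * ssum k j one (flip k)"
proof -
  assume k: "1 \<le> k"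
  have "(\<lambda>i. one i * (one(k := -1)) i) = one(k := -1)" by auto
  then show ?thesis
    using ssum_mult_fixed[OF step_top[OF k], of j one "-1" "flip k"] by metis
qed

text \<open>The second word prolongs at both ends by one step the time during which level \<open>k\<close> is negative,
compared with the first one. Each of the two modifications changes the levels above \<open>k\<close> by the same
affine shift, and the modifications are \<open>Q = 2 ^ l\<close> steps apart, which is a period of the linear part;
so their effects on the final state cancel. The sum of level \<open>k\<close> changes by \<open>2\<close> twice. A
change by \<open>2\<close> alone is impossible for words of equal length with equal final states, by \<open>ssum_mod4\<close>.\<close>

lemma equal_end_switch:
  assumes "1 \<le> k" "k < l"
  shows "\<exists>W1 W2 n. W1 \<in> words n \<and> W2 \<in> words n \<and> mset W1 = mset W2 \<and>
    run l one W1 = run l one W2 \<and> ssum l k one W1 = ssum l k one W2 + 4"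
proof -
  define Q where "Q = (2::nat) ^ l"
  have Q: "l \<le> Q" unfolding Q_def using less_exp[of l] by linarith
  define m where "m = Q - 1 - k"
  have mQ: "m + k + 1 = Q" unfolding m_def using Q assms by simp
  define A where "A = 1 # flip k"
  define B where "B = flip k @ [1]"
  define W1 where "W1 = A @ replicate m 1 @ B"
  define W2 where "W2 = B @ replicate m 1 @ A"
  have AB: "A \<in> words (Suc k)" "B \<in> words (Suc k)"
    using flip_words[of k] by (auto simp: A_def B_def words_def)
  have W: "W1 \<in> words (Suc k + (m + Suc k))" "W2 \<in> words (Suc k + (m + Suc k))"
    unfolding W1_def W2_def using AB replicate_words by (intro append_words; blast)+
  have mset: "mset W1 = mset W2" by (simp add: W1_def W2_def A_def B_def)
  define a where "a = run l one A"
  define b where "b = run l one B"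
  have st: "a \<in> states l" "b \<in> states l" unfolding a_def b_def using AB run_states by auto
  (* c is the affine difference of the two modifications A and B. *)
  define c where "c = (\<lambda>i. a i * b i)"
  have c: "c \<in> states l" unfolding c_def by (rule states_mult[OF st])
  have lA: "length A = Suc k" "length B = Suc k" using AB words_length by auto
  have abc: "a = (\<lambda>i. b i * c i)"
    using states_square[OF st(2)] by (simp add: c_def fun_eq_iff mult.left_commute[of "b _"])
  have "run l one W1 = run l (\<lambda>i. b i * c i) (replicate m 1 @ B)"
    unfolding W1_def run_append[of l one A] a_def[symmetric] using abc by simp
  also have "\<dots> = (\<lambda>i. run l b (replicate m 1 @ B) i * c i)"
    unfolding run_mult using run_ones_period[OF c, of l] Q mQ lA by (simp add: Q_def)
  finally have 1: "run l one W1 = (\<lambda>i. run l b (replicate m 1 @ B) i * c i)" .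
  define x where "x = run l b (replicate m 1)"
  have "run l one W2 = run l x A" by (simp add: W2_def run_append x_def b_def)
  also have "\<dots> = (\<lambda>i. run l x B i * c i)"
    unfolding run_from_one[of l x A] run_from_one[of l x B] lA a_def[symmetric] b_def[symmetric]
    by (subst abc) (simp add: mult_ac)
  finally have ends: "run l one W1 = run l one W2"
    unfolding 1 by (simp add: x_def run_append)
  let ?t = "one(k := -1) :: nat \<Rightarrow> int"
  note simps = ssum_append run_append run_flip[OF assms(1)] run_flip_back[OF assms(1)] ssum_flip[OF assms(1)]
    ssum_flip_back[OF assms(1)] ssum_ones_fixed[of k ?t] assms(1)
  have s1: "ssum k k one W1 = 2 - int m"
    unfolding W1_def A_def B_def using assms(1) by (simp add: simps)
  have s2: "ssum k k one W2 = - 2 - int m"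
    unfolding W2_def A_def B_def using assms(1) by (simp add: simps)
  have level: "ssum l k one W = ssum k k one W" for W
    by (rule ssum_level) (use assms in auto)
  have "ssum l k one W1 = ssum l k one W2 + 4"
    unfolding level s1 s2 by simp
  then show ?thesis using W mset ends by blast
qed

text \<open>The words of the previous lemma may change the sum of level \<open>l\<close>. This is repaired by steering
back to the state of ones and then flipping level \<open>l\<close> once, at a time that depends on the word:
moving this flip changes the sum of level \<open>l\<close> and, since the levels below \<open>l\<close> are \<open>1\<close> around it, no
other sum of a level up to \<open>l\<close>.\<close>

lemma pure_level_switch:
  assumes "1 \<le> k" "k < l"
  shows "\<exists>U1 U2 n. U1 \<in> words n \<and> U2 \<in> words n \<and> mset U1 = mset U2 \<and>
    run l one U1 = one(l := -1) \<and> run l one U2 = one(l := -1) \<and>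
    ssum l k one U1 = ssum l k one U2 + 4 \<and> ssum l l one U1 = ssum l l one U2"
proof -
  obtain W1 W2 n where W: "W1 \<in> words n" "W2 \<in> words n" "mset W1 = mset W2"
    "run l one W1 = run l one W2" "ssum l k one W1 = ssum l k one W2 + 4"
    using equal_end_switch[OF assms] by blast
  have l: "1 \<le> l" using assms by simp
  define z where "z = run l one W1"
  have z: "z \<in> states l" unfolding z_def using W run_states by auto
  define G where "G = steer l 1 l z"
  have G: "G \<in> words l" "run l z G = one"
    unfolding G_def using steer_words[OF z] run_steer[OF z, of 1] l by auto
  have "even (ssum l l one W2 - ssum l l one W1)"
    using ssum_parity[of one l W1 n l] ssum_parity[of one l W2 n l] W by auto
  then obtain e where e: "ssum l l one W2 - ssum l l one W1 = 2 * e" by blast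
  define V where "V = (\<lambda>a b. G @ replicate a 1 @ flip l @ replicate b (1::int))"
  (* The flip of level l comes after a1 ones in one word and after |e| ones in the other one, with
     a1 - |e| = e. *)
  define a1 b1 c1 where "a1 = nat (\<bar>e\<bar> + e)" and "b1 = nat (\<bar>e\<bar> - e)" and "c1 = nat \<bar>e\<bar>"
  have abc: "a1 + b1 = c1 + c1" "int a1 - int b1 = 2 * e" unfolding a1_def b1_def c1_def by auto
  note simps = ssum_append run_append G run_flip[OF l] ssum_flip[OF l] ssum_ones_fixed l
  have V: "V a b \<in> words (l + (a + (l + b)))" "run l z (V a b) = one(l := -1)"
    "ssum l l z (V a b) = ssum l l z G + int a - int l - int b"
    "ssum l k z (V a b) = ssum l k z G + int a + ssum l k one (flip l) + int b" for a b
    unfolding V_def using assms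
    by (intro append_words G flip_words replicate_words | simp add: simps)+
  show ?thesis
  proof (rule exI[of _ "W1 @ V a1 b1"], rule exI[of _ "W2 @ V c1 c1"],
      rule exI[of _ "n + (l + (l + 2 * c1))"], intro conjI)
    show "W1 @ V a1 b1 \<in> words (n + (l + (l + 2 * c1)))"
    proof -
      have "n + (l + (a1 + (l + b1))) = n + (l + (l + 2 * c1))" using abc(1) by simp
      then show ?thesis using append_words[OF W(1) V(1)[of a1 b1]] by (simp only:)
    qed
    show "W2 @ V c1 c1 \<in> words (n + (l + (l + 2 * c1)))"
    proof -
      have "n + (l + (c1 + (l + c1))) = n + (l + (l + 2 * c1))" by simp
      then show ?thesis using append_words[OF W(2) V(1)[of c1 c1]] by (simp only:)
    qed
    have "replicate_mset a1 (1::int) + replicate_mset b1 1 = replicate_mset c1 1 + replicate_mset c1 1"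
      using abc(1) by (intro multiset_eqI) auto
    then show "mset (W1 @ V a1 b1) = mset (W2 @ V c1 c1)"
      using W(3) by (simp add: V_def ac_simps)
    show "run l one (W1 @ V a1 b1) = one(l := -1)" "run l one (W2 @ V c1 c1) = one(l := -1)"
      using V(2) W(4) by (simp_all add: run_append z_def)
    have "ssum l k z (V a1 b1) = ssum l k z (V c1 c1)"
      using V(4) abc(1) by simp
    then show "ssum l k one (W1 @ V a1 b1) = ssum l k one (W2 @ V c1 c1) + 4"
      using W(4,5) by (simp add: ssum_append z_def)
    show "ssum l l one (W1 @ V a1 b1) = ssum l l one (W2 @ V c1 c1)"
      using V(3) e abc(2) W(4) by (simp add: ssum_append z_def)
  qed
qed

context coin
begin

text \<open>After steering to the state of ones, level \<open>K\<close> is flipped either at once or one step later. The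
two words are rearrangements of each other, and the path of the levels below \<open>K\<close> is only
shifted in time past a step at which they are all \<open>1\<close>. So only the sum of level \<open>K\<close> changes.\<close>

lemma one_coordinate_switching:
  assumes K: "1 \<le> K" and I: "K \<in> I"
  obtains sp z c where
    "switching p (2 * K + 1) (run K) (\<lambda>x u j. if j \<in> I then ssum K j x u else 0) (states K)
      {(\<lambda>j. if j = K then 1 else 0), (\<lambda>j. if j = K then -1 else 0)} sp z c
      (min p (1 - p) ^ (2 * K + 1))"
proof -
  let ?L = "2 * K + 1"
  let ?q = "min p (1 - p) ^ ?L"
  let ?Off = "{(\<lambda>j. if j = K then 1 else 0), (\<lambda>j. if j = K then -1 else 0)} :: (nat \<Rightarrow> int) set"
  define home where "home = steer K 1 K"
  define sp where "sp = (\<lambda>x (o1 :: nat \<Rightarrow> int). home x @ (if o1 K = 1 then 1 # flip K else flip K @ [1]))"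
  define c where "c = (\<lambda>x j. if j \<in> I then ssum K j x (home x) + ssum K j one (flip K) + (if j = K then 0 else 1) else 0)"
  have home: "home x \<in> words K" "run K x (home x) = one" if "x \<in> states K" for x
    unfolding home_def using steer_words[OF that] run_steer[OF that, of 1] K by auto
  have w: "sp x o1 \<in> words ?L" if "x \<in> states K" for x o1
  proof -
    have "(if o1 K = 1 then 1 # flip K else flip K @ [1]) \<in> words (Suc K)"
      using flip_words[of K] by (auto simp: words_def)
    from append_words[OF home(1)[OF that] this] show ?thesis
      unfolding sp_def by (simp add: mult_2)
  qed
  have "switching p ?L (run K) (\<lambda>x u j. if j \<in> I then ssum K j x u else 0) (states K)
      ?Off sp (\<lambda>_. one(K := -1)) c ?q"
  proof
    show "0 < ?q" using p_pos p_less_1 by simp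
    fix x o1 o2 assume x: "x \<in> states K" and o: "o1 \<in> ?Off"
    show "sp x o1 \<in> words ?L" using w[OF x] .
    show "?q \<le> wt (sp x o1)" using wt_ge[of "sp x o1"] words_length[OF w[OF x]] by metis
    show "run K x (sp x o1) = one(K := -1)"
      using home(2)[OF x] K by (simp add: sp_def run_append run_flip)
    show "(\<lambda>j. if j \<in> I then ssum K j x (sp x o1) else 0) = (\<lambda>j. c x j + o1 j)"
      using o K I by (auto simp: sp_def c_def run_append run_flip ssum_append home(2)[OF x] fun_eq_iff)
    assume "o2 \<in> ?Off"
    show "mset (sp x o1) = mset (sp x o2)" by (simp add: sp_def)
  qed (auto intro: run_states)
  then show ?thesis by (rule that)
qed

definition off2 :: "nat \<Rightarrow> nat \<Rightarrow> int \<Rightarrow> int \<Rightarrow> nat \<Rightarrow> int" where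
  "off2 k l a b = (\<lambda>j. if j = k then 2 * a else if j = l then b else 0)"

text \<open>A pure switch of level \<open>k\<close> followed by a switch of level \<open>l\<close>, between words that steer to and
stay in the state of ones. The padding makes the block length a multiple of \<open>4\<close>, so that
\<open>ssum_mod4\<close> reads the same at the end of every block.\<close>

lemma two_coordinate_switching:
  assumes k: "1 \<le> k" "k < l"
  obtains L sp c q where
    "switching p L (run l) (\<lambda>x u j. if j \<in> {k, l} then ssum l j x u else 0) (states l)
      {off2 k l a b |a b. a \<in> {1, -1} \<and> b \<in> {1, -1}} sp (\<lambda>_. one) c q"
    "4 dvd L" "0 < L"
proof -
  obtain U1 U2 n where U: "U1 \<in> words n" "U2 \<in> words n" "mset U1 = mset U2"
    "run l one U1 = one(l := -1)" "run l one U2 = one(l := -1)"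
    "ssum l k one U1 = ssum l k one U2 + 4" "ssum l l one U1 = ssum l l one U2"
    using pure_level_switch[OF k] by blast
  have l: "1 \<le> l" using k by simp
  let ?Off = "{off2 k l a b |a b. a \<in> {1, -1} \<and> b \<in> {1, -1}}"
  define m where "m = l + (n + Suc l)"
  define home where "home = steer l 1 l"
  define U where "U = (\<lambda>o1 :: nat \<Rightarrow> int. if o1 k = 2 then U1 else U2)"
  define V where "V = (\<lambda>o1 :: nat \<Rightarrow> int. if o1 l = 1 then flip l @ [1] else 1 # flip l)"
  define sp where "sp = (\<lambda>x o1. home x @ U o1 @ V o1 @ replicate (3 * m) 1)"
  define c where "c = (\<lambda>x j. if j = k
     then ssum l k x (home x) + ssum l k one U1 - 2 + 1 + ssum l k one (flip l) + 3 * int m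
     else if j = l then ssum l l x (home x) + ssum l l one U1 + int l + 3 * int m else 0)"
  have home: "home x \<in> words l" "run l x (home x) = one" if "x \<in> states l" for x
    unfolding home_def using steer_words[OF that] run_steer[OF that, of 1] l by auto
  have UV: "U o1 \<in> words n" "V o1 \<in> words (Suc l)" for o1
    using U(1,2) flip_words[of l] by (auto simp: U_def V_def words_def)
  have w: "sp x o1 \<in> words (4 * m)" if "x \<in> states l" for x o1
  proof -
    have "sp x o1 \<in> words (l + (n + (Suc l + 3 * m)))"
      unfolding sp_def by (intro append_words home[OF that] UV replicate_words)
    also have "l + (n + (Suc l + 3 * m)) = 4 * m" by (simp add: m_def)
    finally show ?thesis .
  qed
  have rU: "run l one (U o1) = one(l := -1)" for o1
    using U by (simp add: U_def)
  have rV: "run l (one(l := -1)) (V o1) = one" for o1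
    using run_flip_back[OF l] l by (simp add: V_def run_append)
  let ?q = "min p (1 - p) ^ (4 * m)"
  have "switching p (4 * m) (run l) (\<lambda>x u j. if j \<in> {k, l} then ssum l j x u else 0) (states l)
      ?Off sp (\<lambda>_. one) c ?q"
  proof
    show "0 < ?q" using p_pos p_less_1 by simp
    have "?Off = (\<lambda>(a, b). off2 k l a b) ` ({1, -1} \<times> {1, -1})" by auto
    then show "finite ?Off" by simp
    show "?Off \<noteq> {}" by auto
    fix x o1 o2 assume x: "x \<in> states l" and o: "o1 \<in> ?Off"
    show "sp x o1 \<in> words (4 * m)" using w[OF x] .
    show "?q \<le> wt (sp x o1)" using wt_ge[of "sp x o1"] words_length[OF w[OF x]] by metis
    show "run l x (sp x o1) = one"
      by (simp add: sp_def run_append home[OF x] rU rV)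
    from o obtain a b where ab: "o1 = off2 k l a b" "a \<in> {1, -1}" "b \<in> {1, -1}" by blast
    have sU: "ssum l k one (U o1) = ssum l k one U1 - 2 + 2 * a" "ssum l l one (U o1) = ssum l l one U1"
      using ab U(6,7) by (auto simp: U_def off2_def)
    have sV: "ssum l k (one(l := -1)) (V o1) = 1 + ssum l k one (flip l)"
      "ssum l l (one(l := -1)) (V o1) = int l + b"
      using ab k l by (auto simp: V_def off2_def ssum_append run_flip_back ssum_flip_back ssum_flip)
    have o1: "o1 k = 2 * a" "o1 l = b" "j \<noteq> k \<Longrightarrow> j \<noteq> l \<Longrightarrow> o1 j = 0" for j
      using k ab(1) by (auto simp: off2_def)
    show "(\<lambda>j. if j \<in> {k, l} then ssum l j x (sp x o1) else 0) = (\<lambda>j. c x j + o1 j)"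
      using k by (auto simp: fun_eq_iff sp_def ssum_append run_append home[OF x] rU rV sU sV
          ssum_ones_fixed c_def o1)
    assume "o2 \<in> ?Off"
    show "mset (sp x o1) = mset (sp x o2)" using U(3) by (simp add: sp_def U_def V_def)
  qed (auto intro: run_states)
  moreover have "4 dvd 4 * m" "0 < 4 * m" by (auto simp: m_def)
  ultimately show ?thesis by (rule that)
qed

end

section \<open>Sums of fair signs\<close>

text \<open>The probability that a sum of \<open>m\<close> independent fair signs equals \<open>- s\<close>, which by symmetry is the
probability that it equals \<open>s\<close>.\<close>

primrec rw :: "nat \<Rightarrow> int \<Rightarrow> real" where
  "rw 0 s = (if s = 0 then 1 else 0)"
| "rw (Suc m) s = (rw m (s - 1) + rw m (s + 1)) / 2"

lemma rw_nonneg: "0 \<le> rw m s"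
  by (induction m arbitrary: s) auto

lemma rw_le_1: "rw m s \<le> 1"
proof (induction m arbitrary: s)
  case (Suc m)
  show ?case using Suc[of "s - 1"] Suc[of "s + 1"] by simp
qed simp

lemma rw_uminus: "rw m (- s) = rw m s"
proof (induction m arbitrary: s)
  case (Suc m)
  have "- s - 1 = - (s + 1)" "- s + 1 = - (s - 1)" by simp_all
  then show ?case using Suc[of "s - 1"] Suc[of "s + 1"] by (simp only: rw.simps add.commute)
qed simp

lemma rw_odd: "odd (int m + s) \<Longrightarrow> rw m s = 0"
  by (induction m arbitrary: s) auto

lemma rw_far: "s < - int m \<Longrightarrow> rw m s = 0"
  by (induction m arbitrary: s) auto

lemma rw_binomial: "rw m (2 * int i - int m) = real (m choose i) / 2 ^ m"
proof (induction m arbitrary: i)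
  case 0
  then show ?case by (cases i) auto
next
  case (Suc m)
  show ?case
  proof (cases i)
    case 0
    then show ?thesis using rw_far[of "- 2 - int m" m] Suc[of 0] by simp
  next
    case (Suc i')
    have "2 * int i - int (Suc m) - 1 = 2 * int i' - int m" "2 * int i - int (Suc m) + 1 = 2 * int i - int m"
      using Suc by auto
    then show ?thesis using Suc.IH[of i] Suc.IH[of i'] Suc by (simp add: field_simps)
  qed
qed

lemma rw_central_Suc:
  "rw (2 * Suc m) 0 = rw (2 * m) 0 * ((2 * m + 1) / (2 * m + 2))"
proof -
  have c: "rw (2 * m) 0 = fact (2 * m) / (fact m * fact m) / 4 ^ m" for m
    using rw_binomial[of "2 * m" m] by (simp add: binomial_fact power_mult)
  have "fact (2 * Suc m) = (2 * real m + 2) * ((2 * real m + 1) * fact (2 * m))"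
    by (simp add: algebra_simps)
  moreover have "fact (Suc m) = (real m + 1) * fact m" by (simp add: algebra_simps)
  ultimately show ?thesis
    unfolding c by (simp add: divide_simps) (simp add: algebra_simps)
qed

text \<open>The product of the squared central probability with \<open>2 * m + 1\<close> decreases in \<open>m\<close>, whereas in the
next lemma the product with \<open>4 * m\<close> increases.\<close>

lemma rw_central_upper: "rw (2 * m) 0 ^ 2 * (2 * m + 1) \<le> 1"
proof (induction m)
  case (Suc m)
  have "rw (2 * Suc m) 0 ^ 2 * (2 * real (Suc m) + 1)
      = (rw (2 * m) 0 ^ 2 * (2 * m + 1)) * ((2 * real m + 1) * (2 * real m + 3) / (2 * real m + 2) ^ 2)"
    unfolding rw_central_Suc by (simp add: field_simps power2_eq_square)
  also have "\<dots> \<le> 1 * 1"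
    using Suc by (intro mult_mono) (simp_all add: power2_eq_square divide_le_eq_1 algebra_simps add_pos_nonneg)
  finally show ?case by simp
qed simp

lemma rw_central_lower: "1 \<le> m \<Longrightarrow> 1 \<le> rw (2 * m) 0 ^ 2 * (4 * m)"
proof (induction m rule: dec_induct)
  case base
  then show ?case by (simp add: numeral_2_eq_2 power2_eq_square)
next
  case (step m)
  have "1 * 1 \<le> (rw (2 * m) 0 ^ 2 * (4 * m)) * ((2 * real m + 1) ^ 2 / (4 * real m * (real m + 1)))"
    using step(1,3)
    by (intro mult_mono) (simp_all add: power2_eq_square le_divide_eq_1 algebra_simps add_pos_nonneg)
  also have "\<dots> = rw (2 * Suc m) 0 ^ 2 * (4 * Suc m)"
    unfolding rw_central_Suc using step(1) by (simp add: divide_simps power2_eq_square) (simp add: algebra_simps)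
  finally show ?case by simp
qed

lemma rw_le_central: "rw (2 * m) s \<le> rw (2 * m) 0"
proof (cases "odd s \<or> s < - int (2 * m)")
  case True
  then show ?thesis using rw_odd[of "2 * m" s] rw_far[of s "2 * m"] rw_nonneg[of "2 * m" 0] by auto
next
  case False
  define i where "i = nat ((s + 2 * int m) div 2)"
  have "s = 2 * int i - int (2 * m)" using False by (auto simp: i_def)
  then have "rw (2 * m) s = real ((2 * m) choose i) / 2 ^ (2 * m)" using rw_binomial by metis
  also have "\<dots> \<le> real ((2 * m) choose m) / 2 ^ (2 * m)"
    using binomial_maximum[of "2 * m" i] by (simp add: divide_right_mono)
  also have "\<dots> = rw (2 * m) 0" using rw_binomial[of "2 * m" m] by simp
  finally show ?thesis .
qed

lemma rw_upper:
  assumes "1 \<le> m" shows "rw m s \<le> 1 / sqrt m"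
proof -
  define k where "k = m div 2"
  have "rw m s \<le> rw (2 * k) 0"
  proof (cases "even m")
    case True
    then show ?thesis using rw_le_central[of k s] by (simp add: k_def)
  next
    case False
    then have "m = Suc (2 * k)" by (simp add: k_def)
    then show ?thesis using rw_le_central[of k "s - 1"] rw_le_central[of k "s + 1"] by simp
  qed
  moreover have "m \<le> 2 * k + 1" by (simp add: k_def)
  then have "rw (2 * k) 0 ^ 2 * m \<le> rw (2 * k) 0 ^ 2 * (2 * k + 1)"
    by (intro mult_left_mono) auto
  then have "rw (2 * k) 0 ^ 2 * m \<le> 1" using rw_central_upper[of k] by simp
  then have "rw (2 * k) 0 ^ 2 \<le> (1 / sqrt m) ^ 2"
    using assms by (simp add: field_simps)
  then have "rw (2 * k) 0 \<le> 1 / sqrt m"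
    by (rule power2_le_imp_le) simp
  ultimately show ?thesis by simp
qed

lemma one_minus_ge_exp: assumes "0 \<le> t" "t \<le> 1/2" shows "exp (- 2 * t) \<le> 1 - (t::real)"
proof -
  have "exp (- 2 * t) = 1 / exp (2 * t)" by (simp add: exp_minus field_simps)
  also have "\<dots> \<le> 1 / (1 + 2 * t)" using assms exp_ge_add_one_self[of "2 * t"] by (intro divide_left_mono) auto
  also have "\<dots> \<le> 1 - t"
  proof -
    have "t * (2 * t) \<le> t * 1" using assms by (intro mult_left_mono) auto
    then have "1 \<le> (1 - t) * (1 + 2 * t)" by (simp add: algebra_simps)
    then show ?thesis using assms by (subst pos_divide_le_eq) auto
  qed
  finally show ?thesis .
qed

text \<open>The ratio of consecutive binomial coefficients at distance \<open>i < j\<close> from the centre is at least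
\<open>1 - 2 * j / m\<close>, and \<open>1 - t \<ge> exp (- 2 * t)\<close> for \<open>t \<le> 1/2\<close>.\<close>

lemma rw_off_central:
  fixes m i j :: nat
  assumes "1 \<le> m" "4 * j \<le> m" "i \<le> j"
  shows "rw (2 * m) 0 * exp (- 4 * real j / real m) ^ i \<le> rw (2 * m) (2 * int i)"
  using assms(3)
proof (induction i)
  case (Suc i)
  have r: "rw (2 * m) (2 * int i) = real ((2 * m) choose (m + i)) / 2 ^ (2 * m)" for i
    using rw_binomial[of "2 * m" "m + i"] by simp
  have "Suc (m + i) * ((2 * m) choose Suc (m + i)) = (2 * m - (m + i)) * ((2 * m) choose (m + i))"
    by (metis binomial_absorb_comp binomial_absorption mult.commute)
  then have "real (Suc (m + i)) * real ((2 * m) choose Suc (m + i)) = (real m - i) * real ((2 * m) choose (m + i))"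
  proof -
    have "real (2 * m - (m + i)) = real m - i" using Suc.prems assms(2) by simp
    then show ?thesis
      using arg_cong[OF \<open>Suc (m + i) * _ = _\<close>, of real] by (simp only: of_nat_mult)
  qed
  then have rec: "rw (2 * m) (2 * int (Suc i)) = rw (2 * m) (2 * int i) * ((real m - i) / (m + i + 1))"
  proof -
    assume "real (Suc (m + i)) * real ((2 * m) choose Suc (m + i)) = (real m - i) * real ((2 * m) choose (m + i))"
    then have "real ((2 * m) choose (m + Suc i)) = real ((2 * m) choose (m + i)) * ((real m - i) / (m + i + 1))"
      by (simp add: eq_divide_eq mult_ac add_ac del: binomial_Suc_Suc)
    then show ?thesis unfolding r by simp
  qed
  have "exp (- 4 * real j / real m) \<le> 1 - 2 * real j / real m"
    using one_minus_ge_exp[of "2 * real j / real m"] assms(1,2) by (simp add: divide_simps)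
  also have "\<dots> \<le> (real m - i) / (m + i + 1)"
  proof -
    have "(1 - 2 * real j / real m) * (m + i + 1) = real m + i + 1 - 2 * real j - 2 * real j * (i + 1) / m"
      using assms(1) by (simp add: field_simps)
    also have "\<dots> \<le> real m + i + 1 - 2 * real j" using assms(1) by simp
    also have "\<dots> \<le> real m - i" using Suc.prems by simp
    finally show ?thesis by (simp add: pos_le_divide_eq)
  qed
  finally have "exp (- 4 * real j / real m) \<le> (real m - i) / (m + i + 1)" .
  moreover have "rw (2 * m) 0 * exp (- 4 * real j / real m) ^ i \<le> rw (2 * m) (2 * int i)" using Suc by simp
  ultimately have "(rw (2 * m) 0 * exp (- 4 * real j / real m) ^ i) * exp (- 4 * real j / real m) \<le> rw (2 * m) (2 * int i) * ((real m - i) / (m + i + 1))"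
    by (intro mult_mono) (auto intro: rw_nonneg)
  then show ?case unfolding rec by (simp add: mult_ac)
qed simp

lemma rw_even_lower:
  assumes "0 \<le> A" "1 \<le> m" "16 * A \<le> m" "even s" "real_of_int (s ^ 2) \<le> 4 * A * m"
  shows "exp (- 4 * A) / (2 * sqrt m) \<le> rw (2 * m) s"
proof -
  define j where "j = nat (\<bar>s\<bar> div 2)"
  have s: "\<bar>s\<bar> = 2 * int j" using assms(4) by (auto simp: j_def)
  have rw: "rw (2 * m) s = rw (2 * m) (2 * int j)"
    using s rw_uminus[of "2 * m" s] by (cases "0 \<le> s") auto
  have "real_of_int (s ^ 2) = real_of_int (\<bar>s\<bar> ^ 2)" by simp
  also have "\<dots> = 4 * real j ^ 2" unfolding s by simp
  finally have j2: "real j ^ 2 \<le> A * m" using assms(5) by simp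
  have "(4 * real j) ^ 2 \<le> real m ^ 2"
  proof -
    have "(4 * real j) ^ 2 \<le> 16 * A * m" using j2 by (simp add: power_mult_distrib)
    also have "\<dots> \<le> real m * m" using assms by (intro mult_right_mono) auto
    finally show ?thesis by (simp add: power2_eq_square)
  qed
  then have "4 * real j \<le> m" by (rule power2_le_imp_le) simp
  then have "rw (2 * m) 0 * exp (- 4 * real j / real m) ^ j \<le> rw (2 * m) (2 * int j)"
    using assms by (intro rw_off_central) auto
  moreover have "exp (- 4 * real j / real m) ^ j = exp (- 4 * (real j ^ 2 / m))"
    unfolding exp_of_nat_mult[symmetric] by (simp add: power2_eq_square)
  moreover have "exp (- 4 * A) \<le> exp (- 4 * (real j ^ 2 / m))"
    using j2 assms(2) by (simp add: divide_simps)
  moreover have "1 / (2 * sqrt m) \<le> rw (2 * m) 0"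
  proof (rule power2_le_imp_le)
    show "(1 / (2 * sqrt m))\<^sup>2 \<le> (rw (2 * m) 0)\<^sup>2"
      using rw_central_lower[OF assms(2)] assms(2) by (simp add: power_divide power_mult_distrib divide_simps)
  qed (rule rw_nonneg)
  ultimately have "1 / (2 * sqrt m) * exp (- 4 * A) \<le> rw (2 * m) 0 * exp (- 4 * real j / real m) ^ j"
    by (intro mult_mono) (auto intro: rw_nonneg)
  then show ?thesis using \<open>rw (2 * m) 0 * exp (- 4 * real j / real m) ^ j \<le> rw (2 * m) (2 * int j)\<close> rw by simp
qed

text \<open>At distance of order \<open>sqrt n\<close> from the centre the probabilities are still of order \<open>1 / sqrt n\<close>. Odd
\<open>n\<close> are reduced to even ones by conditioning on one sign.\<close>

lemma rw_lower:
  assumes "0 \<le> A" "4 \<le> n" "128 * (A + 1) \<le> n" "even (int n + s)" "real_of_int (s ^ 2) \<le> A * n"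
  shows "exp (- 8 * (A + 1)) / (2 * sqrt n) \<le> rw n s"
proof -
  define m where "m = n div 2"
  have m: "1 \<le> m" "m \<le> n" "n \<le> 3 * m" using assms(2) by (auto simp: m_def)
  let ?B = "2 * (A + 1)"
  have B: "0 \<le> ?B" "16 * ?B \<le> m" using assms m(3) m(1) by auto
  have low: "exp (- 8 * (A + 1)) / (2 * sqrt n) \<le> rw (2 * m) t"
    if "even t" "real_of_int (t ^ 2) \<le> 2 * A * n + 2" for t
  proof -
    have "2 * A * n + 2 \<le> 4 * ?B * m"
    proof -
      have "2 * A * n \<le> 2 * A * (3 * m)" using m assms(1) by (intro mult_left_mono) auto
      moreover have "2 * A * (3 * m) + 2 \<le> 4 * ?B * m"
      proof -
        have "2 \<le> 8 * real m" "0 \<le> A * m" using m(1) assms(1) by auto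
        then show ?thesis by (simp add: algebra_simps)
      qed
      ultimately show ?thesis by linarith
    qed
    then have "exp (- 4 * ?B) / (2 * sqrt m) \<le> rw (2 * m) t"
      using that by (intro rw_even_lower[OF B(1) m(1) B(2)]) auto
    moreover have "exp (- 8 * (A + 1)) / (2 * sqrt n) \<le> exp (- 4 * ?B) / (2 * sqrt m)"
      using m by (intro frac_le) auto
    ultimately show ?thesis by linarith
  qed
  show ?thesis
  proof (cases "even n")
    case True
    then have "even s" using assms(4) by auto
    moreover have "real_of_int (s\<^sup>2) \<le> 2 * A * n + 2"
      using assms(5) mult_nonneg_nonneg[OF assms(1), of "real n"] by linarith
    ultimately show ?thesis using low[of s] True by (simp add: m_def)
  next
    case False
    then have n: "n = Suc (2 * m)" by (simp add: m_def)
    have "real_of_int ((s + t) ^ 2) \<le> 2 * A * n + 2" if "t = 1 \<or> t = -1" for t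
    proof -
      have "real_of_int ((s + t) ^ 2) + real_of_int ((s - t) ^ 2) = 2 * real_of_int (s ^ 2) + 2"
        using that by (auto simp: power2_eq_square algebra_simps)
      moreover have "0 \<le> real_of_int ((s - t) ^ 2)" by simp
      ultimately show ?thesis using assms(5) by linarith
    qed
    from low[of "s + 1", OF _ this[of 1]] low[of "s + -1", OF _ this[of "-1"]] False assms(4)
    show ?thesis by (simp add: n)
  qed
qed

section \<open>Second moments\<close>

context coin
begin

text \<open>A lower bound for the weight of every word of length \<open>K\<close>.\<close>

definition \<delta> :: "nat \<Rightarrow> real" where "\<delta> K = min p (1 - p) ^ K"

lemma delta_pos: "0 < \<delta> K" and delta_half: "1 \<le> K \<Longrightarrow> 2 * \<delta> K \<le> 1"
proof -
  show "0 < \<delta> K" using p_pos p_less_1 by (simp add: \<delta>_def)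
  assume "1 \<le> K"
  then have "\<delta> K \<le> min p (1 - p) ^ 1" unfolding \<delta>_def using p_pos p_less_1
    by (intro power_decreasing) auto
  then show "2 * \<delta> K \<le> 1" by (auto simp: min_def split: if_splits)
qed

text \<open>Changing the sign of level \<open>K\<close> in the initial state changes the sign of its whole future. From
every state, two words of length \<open>K\<close> lead to the state of ones and to this state with level \<open>K\<close>
negated; the contributions of the two futures cancel up to the difference of the weights. So each
\<open>K\<close> steps contract the expectation by the factor \<open>1 - 2 * \<delta> K\<close>, while they add at most \<open>K\<close>.\<close>

lemma mean_ssum_bounded:
  assumes K: "1 \<le> K"
  shows "x \<in> states K \<Longrightarrow> \<bar>Ew n (\<lambda>u. real_of_int (ssum K K x u))\<bar> \<le> K / (2 * \<delta> K)"
proof (induction n arbitrary: x rule: less_induct)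
  case (less n)
  let ?B = "K / (2 * \<delta> K)"
  have BK: "real K \<le> ?B" using delta_pos[of K] delta_half[OF K] by (simp add: field_simps mult_left_le)
  show ?case
  proof (cases "n < K")
    case True
    have "\<bar>real_of_int (ssum K K x u)\<bar> \<le> ?B" if "u \<in> words n" for u
    proof -
      have "\<bar>real_of_int (ssum K K x u)\<bar> \<le> real n"
        using ssum_bound[OF less.prems that, of K] by linarith
      then show ?thesis using BK True by linarith
    qed
    then show ?thesis by (intro Ew_abs_le)
  next
    case False
    then obtain n' where n: "n = K + n'" using le_Suc_ex[of K n] by auto
    define m where "m x = Ew n' (\<lambda>u. real_of_int (ssum K K x u))" for x
    have m: "\<bar>m x\<bar> \<le> ?B" if "x \<in> states K" for x
      unfolding m_def using less.IH[of n' x] n K that by simp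
    have anti: "m (one(K := -1)) = - m one"
    proof -
      have "ssum K K (one(K := -1)) u = - ssum K K one u" for u
      proof -
        have "(\<lambda>i. one i * (one(K := -1)) i) = one(K := -1)" by auto
        then show ?thesis using ssum_mult_fixed[OF step_top[OF K], of K one "-1" u] by simp
      qed
      then show ?thesis unfolding m_def using Ew_cmult[of n' "-1"] by simp
    qed
    define a b where "a = steer K 1 K x" and "b = steer K (-1) K x"
    have ab: "a \<in> words K" "b \<in> words K" "run K x a = one" "run K x b = one(K := -1)"
      unfolding a_def b_def
      using steer_words[OF less.prems] run_steer[OF less.prems _ K] by auto
    have "a \<noteq> b" using ab(3,4) by (metis fun_upd_same one_neq_neg_one)
    have wts: "\<delta> K \<le> wt a" "\<delta> K \<le> wt b"
      unfolding \<delta>_def using wt_ge words_length ab(1,2) by metis+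
    have sub: "{a, b} \<subseteq> words K" using ab by simp
    have rest: "wt a + wt b + (\<Sum>u\<in>words K - {a, b}. wt u) = 1"
      using Ew_split[OF sub, of "\<lambda>_. 1"] \<open>a \<noteq> b\<close> by simp
    have "Ew K (\<lambda>u. m (run K x u)) = (wt a - wt b) * m one + (\<Sum>u\<in>words K - {a, b}. wt u * m (run K x u))"
      unfolding Ew_split[OF sub] using \<open>a \<noteq> b\<close> ab(3,4) anti by (simp add: algebra_simps)
    also have "\<bar>\<dots>\<bar> \<le> \<bar>wt a - wt b\<bar> * ?B + (\<Sum>u\<in>words K - {a, b}. wt u * ?B)"
    proof (rule order_trans[OF abs_triangle_ineq], rule add_mono)
      show "\<bar>(wt a - wt b) * m one\<bar> \<le> \<bar>wt a - wt b\<bar> * ?B"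
        unfolding abs_mult using m[of one] by (intro mult_left_mono) auto
      show "\<bar>\<Sum>u\<in>words K - {a, b}. wt u * m (run K x u)\<bar> \<le> (\<Sum>u\<in>words K - {a, b}. wt u * ?B)"
        by (rule order_trans[OF sum_abs], rule sum_mono, unfold abs_mult abs_of_nonneg[OF wt_nonneg],
            intro mult_left_mono m run_states[OF less.prems]) auto
    qed
    also have "\<dots> = (\<bar>wt a - wt b\<bar> + (1 - wt a - wt b)) * ?B"
    proof -
      have "(\<Sum>u\<in>words K - {a, b}. wt u) = 1 - wt a - wt b" using rest by simp
      then show ?thesis unfolding sum_distrib_right[symmetric] distrib_right by (simp only:)
    qed
    also have "\<dots> \<le> (1 - 2 * \<delta> K) * ?B"
      using wts delta_pos[of K] by (intro mult_right_mono) auto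
    also have "\<dots> = ?B - K" using delta_pos[of K] by (simp add: field_simps)
    finally have 1: "\<bar>Ew K (\<lambda>u. m (run K x u))\<bar> \<le> ?B - K" .
    have 2: "\<bar>Ew K (\<lambda>u. real_of_int (ssum K K x u))\<bar> \<le> K"
    proof (rule Ew_abs_le)
      fix u assume "u \<in> words K"
      from ssum_bound[OF less.prems this, of K] show "\<bar>real_of_int (ssum K K x u)\<bar> \<le> K" by linarith
    qed
    have "Ew n (\<lambda>u. real_of_int (ssum K K x u)) = Ew K (\<lambda>u. real_of_int (ssum K K x u)) + Ew K (\<lambda>u. m (run K x u))"
      unfolding n Ew_append m_def by (simp add: ssum_append Ew_add)
    then show ?thesis using 1 2 by linarith
  qed
qed

text \<open>Squaring (first sign) + (rest) adds in each step \<open>1\<close> and twice the first sign times a rest whose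
conditional expectation is bounded by the previous lemma.\<close>

lemma second_moment_top:
  assumes K: "1 \<le> K"
  shows "x \<in> states K \<Longrightarrow> Ew n (\<lambda>u. real_of_int (ssum K K x u) ^ 2) \<le> (1 + K / \<delta> K) * n"
proof (induction n arbitrary: x)
  case (Suc n)
  have *: "Ew n (\<lambda>u. real_of_int (ssum K K x (b # u)) ^ 2) \<le> (1 + K / \<delta> K) * Suc n" if "b \<in> {1, -1}" for b
  proof -
    let ?x = "step K x b"
    have x': "?x \<in> states K" using step_states[OF Suc.prems that] .
    let ?s = "real_of_int (?x K)"
    have s: "?s = 1 \<or> ?s = -1" using states_sign[OF x', of K] by auto
    have "Ew n (\<lambda>u. real_of_int (ssum K K x (b # u)) ^ 2)
        = Ew n (\<lambda>u. 1 + (2 * ?s * real_of_int (ssum K K ?x u) + real_of_int (ssum K K ?x u) ^ 2))"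
      using s by (intro Ew_cong) (auto simp: power2_eq_square algebra_simps)
    also have "\<dots> = 1 + (2 * ?s * Ew n (\<lambda>u. real_of_int (ssum K K ?x u)) + Ew n (\<lambda>u. real_of_int (ssum K K ?x u) ^ 2))"
      by (simp only: Ew_add Ew_cmult Ew_const)
    also have "\<dots> \<le> 1 + (K / \<delta> K + (1 + K / \<delta> K) * n)"
      using mean_ssum_bounded[OF K x', of n] Suc.IH[OF x'] s by (auto simp: field_simps abs_le_iff)
    also have "\<dots> = (1 + K / \<delta> K) * Suc n" by (simp add: algebra_simps add_divide_distrib)
    finally show ?thesis .
  qed
  let ?c = "(1 + K / \<delta> K) * Suc n"
  have "Ew (Suc n) (\<lambda>u. real_of_int (ssum K K x u) ^ 2) \<le> p * ?c + (1 - p) * ?c"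
    unfolding Ew_Suc using *[of 1] *[of "-1"] p_pos p_less_1 by (intro add_mono mult_left_mono) auto
  moreover have "p * ?c + (1 - p) * ?c = ?c" by (simp only: left_diff_distrib)
  ultimately show ?case by linarith
qed simp

lemma second_moment:
  assumes "1 \<le> k" "k \<le> l"
  shows "Ew n (\<lambda>u. real_of_int (ssum l k one u) ^ 2) \<le> (1 + k / \<delta> k) * n"
proof -
  have "ssum l k one u = ssum k k one u" for u
    by (rule ssum_level) (use assms in auto)
  then show ?thesis using second_moment_top[OF assms(1) one_states, of n] by simp
qed

end

section \<open>Decay of the probability of simultaneous zeros\<close>

context switching
begin

text \<open>The number of special blocks among \<open>N\<close> is at least a fixed proportion of \<open>N\<close>, except with
exponentially small probability: this is Markov's inequality for \<open>(1/2) ^ m\<close>. The constant \<open>\<theta>\<close> is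
chosen so small that the factor \<open>2 powr (\<theta> * N)\<close> does not spoil the decay.\<close>

lemma special_blocks_frequent:
  assumes "X \<noteq> {}"
  shows "\<exists>\<theta> \<rho>. 0 < \<theta> \<and> 0 < \<rho> \<and> \<rho> < 1 \<and>
    (\<forall>N. \<forall>x\<in>X. \<forall>v. (Tc ^^ N) (\<lambda>x v m. of_bool (real m < \<theta> * real N)) x v 0 \<le> \<rho> ^ N)"
proof -
  have q1: "q \<le> 1" using assms q_le_1 by auto
  (* With 2 powr \<theta> = t, Markov's inequality turns the rate 1 - q / 2 into t * (1 - q / 2) = 1 - q / 4. *)
  define t where "t = (1 - q / 4) / (1 - q / 2)"
  define \<theta> where "\<theta> = log 2 t"
  have t: "1 < t" "t * (1 - q / 2) = 1 - q / 4" using q_pos q1 by (simp_all add: t_def)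
  have \<theta>: "0 < \<theta>" "2 powr \<theta> = t" using t by (simp_all add: \<theta>_def)
  have "(Tc ^^ N) (\<lambda>x v m. of_bool (real m < \<theta> * real N)) x v 0 \<le> (1 - q / 4) ^ N" if "x \<in> X" for N x v
  proof -
    have le: "of_bool (real m < \<theta> * real N) \<le> 2 powr (\<theta> * real N) * (1 / 2) ^ m" for m
    proof (cases "real m < \<theta> * real N")
      case True
      have "(1::real) = 2 ^ m * (1 / 2) ^ m" by (simp add: power_divide)
      also have "\<dots> = 2 powr m * (1 / 2) ^ m" by (simp add: powr_realpow)
      also have "\<dots> \<le> 2 powr (\<theta> * real N) * (1 / 2) ^ m" using True by (intro mult_right_mono powr_mono) auto
      finally show ?thesis using True by simp
    qed simp
    have "(Tc ^^ N) (\<lambda>x v m. of_bool (real m < \<theta> * real N)) x v 0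
        \<le> (Tc ^^ N) (\<lambda>x v m. 2 powr (\<theta> * real N) * (1 / 2) ^ m) x v 0"
      by (rule Tc_pow_mono'[OF le that])
    also have "\<dots> = 2 powr (\<theta> * real N) * (Tc ^^ N) (\<lambda>x v m. (1 / 2) ^ m) x v 0" by (rule Tc_pow_cmult)
    also have "\<dots> \<le> 2 powr (\<theta> * real N) * (1 - q / 2) ^ N"
      using few_special_blocks[OF that, of N v 0] by (intro mult_left_mono) auto
    also have "2 powr (\<theta> * real N) = t ^ N" using \<theta> t by (simp add: powr_powr[symmetric] powr_realpow)
    also have "t ^ N * (1 - q / 2) ^ N = (1 - q / 4) ^ N" using t by (simp add: power_mult_distrib[symmetric])
    finally show ?thesis .
  qed
  then show ?thesis using \<theta>(1) q_pos q1 by (intro exI[of _ \<theta>] exI[of _ "1 - q / 4"]) auto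
qed

lemma T_pow_Ew:
  assumes "\<And>x. R x [] = x" "\<And>x u w. R x (u @ w) = R (R x u) w"
    and "\<And>x j. D x [] j = 0" "\<And>x u w j. D x (u @ w) j = D x u j + D (R x u) w j"
  shows "(T ^^ N) g x v = Ew (N * L) (\<lambda>u. g (R x u) (\<lambda>j. v j + D x u j))"
proof (induction N arbitrary: x v)
  case (Suc N)
  then show ?case
    unfolding mult_Suc Ew_append by (simp add: T_def[of "(T ^^ N) g"] assms(2,4) add.assoc)
qed (simp add: assms)

end

context coin
begin

text \<open>The probability that the partial sums of all levels in \<open>I\<close> vanish at time \<open>n\<close>.\<close>

definition zero_prob :: "nat \<Rightarrow> nat set \<Rightarrow> nat \<Rightarrow> real" where
  "zero_prob K I n = Ew n (\<lambda>u. of_bool (\<forall>j\<in>I. ssum K j one u = 0))"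

lemma zero_prob_nonneg: "0 \<le> zero_prob K I n"
  unfolding zero_prob_def by (intro Ew_nonneg) auto

lemma zero_prob_le_1: "zero_prob K I n \<le> 1"
  unfolding zero_prob_def using Ew_mono[of n _ "\<lambda>_. 1"] by auto

lemma zero_prob_level:
  assumes "I \<subseteq> {1..k}" "k \<le> l"
  shows "zero_prob l I n = zero_prob k I n"
proof -
  have "ssum l j one u = ssum k j one u" if "j \<in> I" for j u
    by (rule ssum_level) (use that assms in auto)
  then show ?thesis by (simp add: zero_prob_def)
qed

text \<open>Each further level costs a factor \<open>1 / sqrt n\<close>. The switches of the top level \<open>K\<close> do not affect the
sums of the levels in \<open>J\<close>; given everything else, the sum of level \<open>K\<close> is a constant plus a sum of
fair signs, one for each special block, and \<open>rw_upper\<close> applies unless there are few of them.\<close>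

lemma zero_prob_blocks:
  assumes J: "J \<subseteq> {1..<K}" and K: "1 \<le> K"
  shows "\<exists>\<theta> \<rho>. 0 < \<theta> \<and> 0 < \<rho> \<and> \<rho> < 1 \<and>
    (\<forall>N\<ge>1. \<forall>r. zero_prob K (insert K J) (r + N * (2 * K + 1))
      \<le> 1 / sqrt (\<theta> * real N) * zero_prob K J (r + N * (2 * K + 1)) + \<rho> ^ N)"
proof -
  define I where "I = insert K J"
  define D where "D = (\<lambda>x u j. if j \<in> I then ssum K j x u else 0)"
  let ?L = "2 * K + 1"
  let ?o1 = "(\<lambda>j. if j = K then 1 else 0) :: nat \<Rightarrow> int"
  let ?o2 = "(\<lambda>j. if j = K then -1 else 0) :: nat \<Rightarrow> int"
  obtain sp z c where sw: "switching p ?L (run K) D (states K) {?o1, ?o2} sp z c (min p (1 - p) ^ ?L)"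
    unfolding D_def using one_coordinate_switching[OF K, of I] by (auto simp: I_def)
  interpret S: switching p ?L "run K" D "states K" "{?o1, ?o2}" sp z c "min p (1 - p) ^ ?L"
    by (rule sw)
  have "?o1 K \<noteq> ?o2 K" by simp
  then have o12: "?o1 \<noteq> ?o2" by metis
  have KJ: "K \<notin> J" using J by auto
  define H :: "(nat \<Rightarrow> int) \<Rightarrow> real" where "H = (\<lambda>v. of_bool (\<forall>j\<in>J. v j = 0))"
  define G :: "(nat \<Rightarrow> int) \<Rightarrow> real" where "G = (\<lambda>v. of_bool (\<forall>j\<in>I. v j = 0))"
  have states_ne: "states K \<noteq> {}" using one_states by blast
  have Hadd: "H (\<lambda>j. v j + ?o1 j) = H v" "H (\<lambda>j. v j + ?o2 j) = H v" for v
    unfolding H_def using KJ by (auto intro!: arg_cong[where f = of_bool])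
  have Av: "S.Av g x v = (g x (\<lambda>j. v j + ?o1 j) + g x (\<lambda>j. v j + ?o2 j)) / 2" for g x v
    unfolding S.Av_def using o12 by simp
  have AvH: "(S.Av ^^ m) (\<lambda>x. H) x v = H v" for m x v
    by (induction m arbitrary: v) (simp_all add: Av Hadd)
  have AvG: "(S.Av ^^ m) (\<lambda>x. G) x v = H v * rw m (v K)" for m x v
  proof (induction m arbitrary: v)
    case 0
    then show ?case by (auto simp: G_def H_def I_def)
  next
    case (Suc m)
    then show ?case by (simp add: Av Hadd field_simps)
  qed
  obtain \<theta> \<rho> where \<theta>: "0 < \<theta>" "0 < \<rho>" "\<rho> < 1"
    and few: "\<forall>N. \<forall>x\<in>states K. \<forall>v. (S.Tc ^^ N) (\<lambda>x v m. of_bool (real m < \<theta> * real N)) x v 0 \<le> \<rho> ^ N"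
    using S.special_blocks_frequent[OF states_ne] by (elim exE conjE)
  have TE: "(S.T ^^ N) g x v = Ew (N * ?L) (\<lambda>u. g (run K x u) (\<lambda>j. v j + D x u j))" for N g x v
    by (rule S.T_pow_Ew) (auto simp: run_append D_def ssum_append)
  have block: "(S.T ^^ N) (\<lambda>x. G) x v \<le> 1 / sqrt (\<theta> * real N) * (S.T ^^ N) (\<lambda>x. H) x v + \<rho> ^ N"
    if x: "x \<in> states K" and N: "1 \<le> N" for x v N
  proof -
    have "(S.T ^^ N) (\<lambda>x. G) x v = (S.Tc ^^ N) (\<lambda>x v m. H v * rw m (v K)) x v 0"
      unfolding S.T_pow_eq[OF x] AvG ..
    also have "\<dots> \<le> (S.Tc ^^ N) (\<lambda>x v m. 1 / sqrt (\<theta> * real N) * H v + of_bool (real m < \<theta> * real N)) x v 0"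
    proof (rule S.Tc_pow_mono'[OF _ x])
      fix v :: "nat \<Rightarrow> int" and m
      have H: "0 \<le> H v" "H v \<le> 1" by (auto simp: H_def)
      show "H v * rw m (v K) \<le> 1 / sqrt (\<theta> * real N) * H v + of_bool (real m < \<theta> * real N)"
      proof (cases "real m < \<theta> * real N")
        case True
        have "H v * rw m (v K) \<le> 1 * 1" using H rw_le_1 rw_nonneg by (intro mult_mono) auto
        moreover have "0 \<le> 1 / sqrt (\<theta> * real N) * H v" using H \<theta> by simp
        ultimately show ?thesis using True by simp
      next
        case False
        have "0 < \<theta> * real N" using \<theta> N by simp
        then have m: "1 \<le> m" using False by (cases m) auto
        have "rw m (v K) \<le> 1 / sqrt m" by (rule rw_upper[OF m])
        also have "\<dots> \<le> 1 / sqrt (\<theta> * real N)" using False \<open>0 < \<theta> * real N\<close> by (intro divide_left_mono) auto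
        finally have "H v * rw m (v K) \<le> H v * (1 / sqrt (\<theta> * real N))" using H by (intro mult_left_mono)
        then show ?thesis using False by (simp add: mult.commute)
      qed
    qed
    also have "\<dots> = 1 / sqrt (\<theta> * real N) * (S.Tc ^^ N) (\<lambda>x v m. H v) x v 0
        + (S.Tc ^^ N) (\<lambda>x v m. of_bool (real m < \<theta> * real N)) x v 0"
      unfolding S.Tc_pow_add S.Tc_pow_cmult ..
    also have "(S.Tc ^^ N) (\<lambda>x v m. H v) x v 0 = (S.T ^^ N) (\<lambda>x. H) x v"
      unfolding S.T_pow_eq[OF x] AvH ..
    finally show ?thesis using few[rule_format, OF x, of N v] by linarith
  qed
  have G_sums: "of_bool (\<forall>j\<in>I. ssum K j one u = 0) = G (D one u)" for u
    by (auto simp: G_def D_def)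
  have H_sums: "of_bool (\<forall>j\<in>J. ssum K j one u = 0) = H (D one u)" for u
    by (auto simp: H_def D_def I_def)
  have Dadd: "D one (u @ w) = (\<lambda>j. D one u j + D (run K one u) w j)" for u w
    by (auto simp: D_def ssum_append)
  show ?thesis
  proof (rule exI[of _ \<theta>], rule exI[of _ \<rho>], intro conjI \<theta> allI impI)
    fix N r :: nat assume N: "1 \<le> N"
    have "zero_prob K I (r + N * ?L) = Ew r (\<lambda>u. (S.T ^^ N) (\<lambda>x. G) (run K one u) (D one u))"
      unfolding zero_prob_def G_sums Ew_append TE Dadd ..
    also have "\<dots> \<le> Ew r (\<lambda>u. 1 / sqrt (\<theta> * real N) * (S.T ^^ N) (\<lambda>x. H) (run K one u) (D one u) + \<rho> ^ N)"
      by (intro Ew_mono block N run_states[OF one_states])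
    also have "\<dots> = 1 / sqrt (\<theta> * real N) * Ew r (\<lambda>u. (S.T ^^ N) (\<lambda>x. H) (run K one u) (D one u)) + \<rho> ^ N"
      unfolding Ew_add Ew_cmult Ew_const ..
    also have "Ew r (\<lambda>u. (S.T ^^ N) (\<lambda>x. H) (run K one u) (D one u)) = zero_prob K J (r + N * ?L)"
      unfolding zero_prob_def H_sums Ew_append TE Dadd ..
    finally show "zero_prob K (insert K J) (r + N * ?L)
      \<le> 1 / sqrt (\<theta> * real N) * zero_prob K J (r + N * ?L) + \<rho> ^ N" by (simp add: I_def)
  qed
qed

lemma zero_prob_step:
  assumes J: "J \<subseteq> {1..<K}" and K: "1 \<le> K"
  shows "\<exists>C>0. \<forall>n\<ge>1. zero_prob K (insert K J) n \<le> C / sqrt n * zero_prob K J n + C / real n ^ 2"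
proof -
  obtain \<theta> \<rho> where \<theta>: "0 < \<theta>" "0 < \<rho>" "\<rho> < 1"
    and z: "\<forall>N\<ge>1. \<forall>r. zero_prob K (insert K J) (r + N * (2 * K + 1))
      \<le> 1 / sqrt (\<theta> * real N) * zero_prob K J (r + N * (2 * K + 1)) + \<rho> ^ N"
    using zero_prob_blocks[OF assms] by (elim exE conjE)
  define L where "L = 2 * K + 1"
  have L: "1 \<le> L" by (simp add: L_def)
  have "norm (sqrt \<rho>) < 1" using \<theta> by simp
  then have "(\<lambda>n. real n * sqrt \<rho> ^ n) \<longlonglongrightarrow> 0" by (rule powser_times_n_limit_0)
  then have "Bseq (\<lambda>n. real n * sqrt \<rho> ^ n)" by (intro convergent_imp_Bseq convergentI)
  then obtain B where B: "0 < B" "\<And>n. norm (real n * sqrt \<rho> ^ n) \<le> B"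
    by (auto simp: Bseq_def)
  have rho: "\<rho> ^ N \<le> B ^ 2 / real N ^ 2" if "1 \<le> N" for N
  proof -
    have "(real N * sqrt \<rho> ^ N) ^ 2 \<le> B ^ 2" using B(2)[of N] \<theta> by (intro power_mono) auto
    also have "(real N * sqrt \<rho> ^ N) ^ 2 = real N ^ 2 * \<rho> ^ N"
      using \<theta> by (simp add: power_mult_distrib power_mult[symmetric] mult.commute[of N])
        (simp add: power_mult)
    finally show ?thesis using that by (simp add: field_simps)
  qed
  define C where "C = sqrt (2 * L / \<theta>) + 4 * real L ^ 2 * B ^ 2 + real L ^ 2"
  have C: "sqrt (2 * L / \<theta>) \<le> C" "4 * real L ^ 2 * B ^ 2 \<le> C" "real L ^ 2 \<le> C" "0 < C"
    unfolding C_def using \<theta> L by (auto intro!: add_nonneg_pos)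
  show ?thesis
  proof (rule exI[of _ C], intro conjI C(4) allI impI)
    fix n :: nat assume n: "1 \<le> n"
    show "zero_prob K (insert K J) n \<le> C / sqrt n * zero_prob K J n + C / real n ^ 2"
    proof (cases "n < L")
      case True
      then have "real n ^ 2 \<le> real L ^ 2" by (intro power_mono) auto
      then have "real n ^ 2 \<le> C" using C(3) by linarith
      then have "1 \<le> C / real n ^ 2" using n by (simp add: field_simps)
      moreover have "0 \<le> C / sqrt n * zero_prob K J n" using C(4) zero_prob_nonneg by simp
      ultimately show ?thesis using zero_prob_le_1[of K "insert K J" n] by linarith
    next
      case False
      define N where "N = n div L"
      have N: "1 \<le> N" unfolding N_def using False L by (simp add: Suc_le_eq div_greater_zero_iff)
      have nN: "n mod L + N * (2 * K + 1) = n" unfolding N_def L_def[symmetric] by (rule mod_div_mult_eq)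
      have "n < Suc N * L" using L dividend_less_div_times[of L n] by (simp add: N_def add.commute)
      also have "\<dots> \<le> 2 * N * L" using N by (intro mult_right_mono) auto
      finally have "real n \<le> real (2 * N * L)" by linarith
      then have n2: "real n \<le> 2 * real L * N" by (simp add: mult_ac)
      have "1 / sqrt (\<theta> * real N) \<le> C / sqrt n"
      proof -
        have "sqrt n \<le> sqrt (2 * L / \<theta> * (\<theta> * real N))" using n2 \<theta> by (intro real_sqrt_le_mono) (simp add: field_simps)
        also have "\<dots> = sqrt (2 * L / \<theta>) * sqrt (\<theta> * real N)" by (rule real_sqrt_mult)
        also have "\<dots> \<le> C * sqrt (\<theta> * real N)" using C(1) \<theta> by (intro mult_right_mono) auto
        finally show ?thesis using n N \<theta> by (simp add: field_simps)
      qed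
      then have 1: "1 / sqrt (\<theta> * real N) * zero_prob K J n \<le> C / sqrt n * zero_prob K J n"
        using zero_prob_nonneg by (intro mult_right_mono) auto
      have "\<rho> ^ N \<le> C / real n ^ 2"
      proof -
        have "real n ^ 2 \<le> (2 * real L * N) ^ 2" using n2 by (intro power_mono) auto
        then have "real n ^ 2 * B ^ 2 \<le> (2 * real L * N) ^ 2 * B ^ 2" by (intro mult_right_mono) auto
        also have "\<dots> = 4 * real L ^ 2 * B ^ 2 * real N ^ 2" by (simp add: power_mult_distrib)
        also have "\<dots> \<le> C * real N ^ 2" using C(2) by (intro mult_right_mono) auto
        finally have "B ^ 2 / real N ^ 2 \<le> C / real n ^ 2" using n N by (simp add: field_simps)
        then show ?thesis using rho[OF N] by simp
      qed
      with 1 z[rule_format, OF N, of "n mod L"] show ?thesis unfolding nN by linarith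
    qed
  qed
qed

lemma zero_prob_decay_step:
  assumes J: "J \<subseteq> {1..<K}" and K: "1 \<le> K" and a: "a \<le> 1"
    and dec: "\<And>n. 1 \<le> n \<Longrightarrow> zero_prob K J n \<le> B * real n powr (- a)"
  shows "\<exists>C. \<forall>n\<ge>1. zero_prob K (insert K J) n \<le> C * real n powr (- (a + 1/2))"
proof -
  obtain C where C: "0 < C"
    "\<forall>n\<ge>1. zero_prob K (insert K J) n \<le> C / sqrt n * zero_prob K J n + C / real n ^ 2"
    using zero_prob_step[OF J K] by (elim exE conjE)
  have "zero_prob K (insert K J) n \<le> (C * B + C) * real n powr (- (a + 1/2))" if n: "1 \<le> n" for n
  proof -
    have root: "C / sqrt n = C * real n powr (- (1/2))"
      by (simp add: powr_minus_divide powr_half_sqrt)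
    have "C / sqrt n * zero_prob K J n \<le> C * real n powr (- (1/2)) * (B * real n powr (- a))"
      unfolding root using C dec[OF n] by (intro mult_left_mono) auto
    also have "C * real n powr (- (1/2)) * (B * real n powr (- a)) = C * B * (real n powr (- (1/2)) * real n powr (- a))"
      by (simp only: mult_ac)
    also have "real n powr (- (1/2)) * real n powr (- a) = real n powr (- (a + 1/2))"
    proof -
      have "- (1/2) + - a = - (a + 1/2)" by simp
      then show ?thesis using powr_add[of "real n" "- (1/2)" "- a"] by (simp only:)
    qed
    finally have 1: "C / sqrt n * zero_prob K J n \<le> C * B * real n powr (- (a + 1/2))" .
    have "C / real n ^ 2 = C * real n powr (- 2)"
      using n by (simp add: powr_minus_divide)
    also have "\<dots> \<le> C * real n powr (- (a + 1/2))"
      using C n a by (intro mult_left_mono powr_mono) auto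
    finally show ?thesis using 1 C(2)[rule_format, OF n] unfolding distrib_right by linarith
  qed
  then show ?thesis by blast
qed

text \<open>The previous lemma is applied to the lowest level, then the middle one, then the highest one, which
gives the exponents \<open>1/2\<close>, \<open>1\<close> and finally \<open>3/2\<close>.\<close>

lemma zero_prob_three_summable:
  assumes "1 \<le> a" "a < b" "b < c" "c \<le> K"
  shows "summable (zero_prob K {a, b, c})"
proof -
  have l: "zero_prob b {a} n = zero_prob a {a} n" "zero_prob c {b, a} n = zero_prob b {b, a} n" for n
    using assms by (intro zero_prob_level; auto)+
  have "\<exists>C. \<forall>n\<ge>1. zero_prob a {a} n \<le> C * real n powr (- (0 + 1/2))"
    by (rule zero_prob_decay_step[where B = 1]) (use assms zero_prob_le_1 in auto)
  then obtain C1 where C1: "\<forall>n\<ge>1. zero_prob a {a} n \<le> C1 * real n powr (- (0 + 1/2))" ..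
  have "\<exists>C. \<forall>n\<ge>1. zero_prob b {b, a} n \<le> C * real n powr (- (1/2 + 1/2))"
    by (rule zero_prob_decay_step[where B = C1]) (use assms C1 l(1) in auto)
  then obtain C2 where C2: "\<forall>n\<ge>1. zero_prob b {b, a} n \<le> C2 * real n powr (- (1/2 + 1/2))" ..
  have "\<exists>C. \<forall>n\<ge>1. zero_prob c {c, b, a} n \<le> C * real n powr (- (1 + 1/2))"
    by (rule zero_prob_decay_step[where B = C2]) (use assms C2 l(2) in auto)
  then obtain C3 where C3: "\<forall>n\<ge>1. zero_prob c {c, b, a} n \<le> C3 * real n powr (- (1 + 1/2))" ..
  have "summable (\<lambda>n. C3 * real n powr (- (1 + 1/2)))"
    by (intro summable_mult) (simp add: summable_real_powr_iff)
  then have "summable (zero_prob c {c, b, a})"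
    by (rule summable_comparison_test'[where N = 1]) (use C3 zero_prob_nonneg in auto)
  moreover have "zero_prob K {a, b, c} = zero_prob c {c, b, a}"
    using zero_prob_level[of "{a, b, c}" c K] assms by (auto simp: insert_commute)
  ultimately show ?thesis by simp
qed

end

section \<open>Returns in two coordinates\<close>

text \<open>The same as \<open>rw\<close> for signs multiplied by \<open>2\<close>.\<close>

definition rw2 :: "nat \<Rightarrow> int \<Rightarrow> real" where
  "rw2 m s = (if even s then rw m (s div 2) else 0)"

lemma rw2_0: "rw2 0 s = of_bool (s = 0)"
  by (auto simp: rw2_def)

lemma rw2_Suc: "rw2 (Suc m) s = (rw2 m (s - 2) + rw2 m (s + 2)) / 2"
proof (cases "even s")
  case True
  then obtain t where "s = 2 * t" by blast
  moreover have "(2 * t - 2) div 2 = t - 1" "(2 * t + 2) div 2 = t + 1" by auto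
  ultimately show ?thesis by (simp add: rw2_def)
qed (simp add: rw2_def)

lemma rw2_nonneg: "0 \<le> rw2 m s"
  by (simp add: rw2_def rw_nonneg)

context coin
begin

text \<open>A local lower bound of order \<open>1 / N\<close>. By the switching identity the return probability is the
expectation, for the centred process, of the product of two probabilities \<open>rw2\<close> and \<open>rw\<close>. Each is of
order \<open>1 / sqrt N\<close> when the centred sums are of order \<open>sqrt N\<close>, the number of special blocks is of
order \<open>N\<close>, and the parities match. The first two conditions hold with high probability: averaging
can only increase the squares, so the centred sums have at most the second moments of the original
ones. The parities match automatically when the final state consists of ones. The state of ones
itself is reached with probability at least \<open>q\<close>, because the special blocks end there.\<close>

lemma return_probability_lower_bound:
  assumes kl: "1 \<le> k" "k < l"
  shows "\<exists>L c N0. 0 < L \<and> 0 < c \<and> (\<forall>N\<ge>N0. c / real N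
    \<le> Ew (N * L) (\<lambda>u. of_bool (run l one u = one \<and> ssum l k one u = 0 \<and> ssum l l one u = 0)))"
proof -
  define D where "D = (\<lambda>x u j. if j \<in> {k, l} then ssum l j x u else 0)"
  define Offs where "Offs = {off2 k l a b |a b. a \<in> {1, -1} \<and> b \<in> {1, -1}}"
  obtain L sp c q where sw: "switching p L (run l) D (states l) Offs sp (\<lambda>_. one) c q"
    and L: "4 dvd L" "0 < L"
    unfolding D_def Offs_def by (rule two_coordinate_switching[OF kl])
  interpret S: switching p L "run l" D "states l" Offs sp "\<lambda>_. one" c q by (rule sw)
  have k1: "Suc k \<le> l" "k \<noteq> l" "1 \<le> l" using kl by auto
  have off: "off2 k l a b k = 2 * a" "off2 k l a b l = b" for a b
    using k1 by (auto simp: off2_def)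
  have Off_eq: "Offs = (\<lambda>(a, b). off2 k l a b) ` ({1, -1} \<times> {1, -1})" by (auto simp: Offs_def)
  have inj: "inj_on (\<lambda>(a, b). off2 k l a b) ({1, -1} \<times> {1, -1})"
    by (rule inj_onI) (use off in \<open>auto dest: arg_cong[where f = "\<lambda>f. (f k, f l)"]\<close>)
  have Av: "S.Av g x v = (g x (\<lambda>j. v j + off2 k l 1 1 j) + g x (\<lambda>j. v j + off2 k l 1 (-1) j)
      + g x (\<lambda>j. v j + off2 k l (-1) 1 j) + g x (\<lambda>j. v j + off2 k l (-1) (-1) j)) / 4" for g x v
  proof -
    have "(\<Sum>o1\<in>Offs. f o1) = f (off2 k l 1 1) + f (off2 k l 1 (-1)) + f (off2 k l (-1) 1) + f (off2 k l (-1) (-1))"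
      for f :: "(nat \<Rightarrow> int) \<Rightarrow> real"
      unfolding Off_eq sum.reindex[OF inj] by (simp add: sum.cartesian_product[symmetric])
    moreover have "card Offs = 4" unfolding Off_eq card_image[OF inj] by simp
    ultimately show ?thesis by (simp only: S.Av_def)
  qed
  define G where "G = (\<lambda>(x :: nat \<Rightarrow> int) v. of_bool (x = one \<and> v k = (0::int) \<and> v l = (0::int)) :: real)"
  define Sq where "Sq = (\<lambda>v. (real_of_int (v k)) ^ 2 + (real_of_int (v l)) ^ 2)"
  have AvG: "(S.Av ^^ m) G x v = of_bool (x = one) * rw2 m (v k) * rw m (v l)" for m x v
  proof (induction m arbitrary: v)
    case 0
    then show ?case by (simp add: G_def rw2_0)
  next
    case (Suc m)
    then show ?case by (simp add: Av off rw2_Suc field_simps)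
  qed
  have AvSq: "(S.Av ^^ m) (\<lambda>x. Sq) x v = Sq v + 5 * m" for m x v
  proof (induction m arbitrary: v)
    case (Suc m)
    then show ?case by (simp add: Av off Sq_def power2_eq_square algebra_simps)
  qed simp
  have TE: "(S.T ^^ N) g one (\<lambda>_. 0) = Ew (N * L) (\<lambda>u. g (run l one u) (D one u))" for N g
    by (subst S.T_pow_Ew) (auto simp: run_append D_def ssum_append)
  obtain \<theta> \<rho> where \<theta>: "0 < \<theta>" "0 < \<rho>" "\<rho> < 1"
    and few: "\<forall>N. \<forall>x\<in>states l. \<forall>v. (S.Tc ^^ N) (\<lambda>x v m. of_bool (real m < \<theta> * real N)) x v 0 \<le> \<rho> ^ N"
  proof -
    have "states l \<noteq> {}" using one_states by blast
    from S.special_blocks_frequent[OF this] show ?thesis using that by (elim exE conjE)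
  qed
  define B where "B = (1 + k / \<delta> k) + (1 + l / \<delta> l)"
  have B: "0 < B" unfolding B_def using delta_pos[of k] delta_pos[of l] by (intro add_pos_nonneg) auto
  have q: "0 < q" by (rule S.q_pos)
  (* A is so large that the centred sums violate Sq v \<le> A * N with probability at most q / 4; since
     m \<ge> \<theta> * N, this inequality then implies Sq v \<le> A' * m. *)
  define A where "A = 4 * B * L / q"
  define A' where "A' = A / \<theta>"
  have A: "0 < A" "0 < A'" unfolding A'_def A_def using B L q \<theta> by auto
  define e where "e = exp (- 8 * (A' + 1)) / 2"
  have e: "0 < e" by (simp add: e_def)
  have second: "(S.Tc ^^ N) (\<lambda>x v m. Sq v) one (\<lambda>_. 0) 0 \<le> B * (N * L)" for N
  proof -
    have "(S.Tc ^^ N) (\<lambda>x v m. Sq v) one (\<lambda>_. 0) 0 \<le> (S.Tc ^^ N) (\<lambda>x v m. (S.Av ^^ m) (\<lambda>x. Sq) x v) one (\<lambda>_. 0) 0"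
      by (rule S.Tc_pow_mono') (simp_all add: AvSq)
    also have "\<dots> = Ew (N * L) (\<lambda>u. Sq (D one u))"
      unfolding S.T_pow_eq[OF one_states, symmetric] TE ..
    also have "\<dots> = Ew (N * L) (\<lambda>u. real_of_int (ssum l k one u) ^ 2) + Ew (N * L) (\<lambda>u. real_of_int (ssum l l one u) ^ 2)"
      by (simp add: Sq_def D_def Ew_add)
    also have "\<dots> \<le> (1 + k / \<delta> k) * (N * L) + (1 + l / \<delta> l) * (N * L)"
      using second_moment[of k l "N * L"] second_moment[of l l "N * L"] kl by (intro add_mono) auto
    also have "\<dots> = B * (N * L)" by (simp add: B_def algebra_simps)
    finally show ?thesis .
  qed
  have home: "q \<le> (S.Tc ^^ N) (\<lambda>x v m. of_bool (x = one)) one (\<lambda>_. 0) 0" if N_pos: "1 \<le> N" for N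
  proof -
    obtain N' where N: "N = Suc N'" using N_pos by (cases N) auto
    have const: "(S.Tc ^^ n) (\<lambda>x v m. q) x v m = q" for n x v m
      by (induction n arbitrary: x v m) (simp_all add: S.Tc_def)
    have "q = (S.Tc ^^ N') (\<lambda>x v m. q) one (\<lambda>_. 0) 0" by (simp add: const)
    also have "\<dots> \<le> (S.Tc ^^ N') (S.Tc (\<lambda>x v m. of_bool (x = one))) one (\<lambda>_. 0) 0"
    proof (rule S.Tc_pow_mono'[OF _ one_states])
      fix x v m assume x: "x \<in> states l"
      have "q \<le> (\<Sum>u\<in>S.spec x. wt u)" by (rule S.spec_wt[OF x])
      also have "\<dots> = (\<Sum>u\<in>S.spec x. wt u * of_bool (run l x u = one))"
        using S.sp_R[OF x] by (intro sum.cong) (auto simp: S.spec_def)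
      also have "\<dots> \<le> S.Tc (\<lambda>x v m. of_bool (x = one)) x v m"
        unfolding S.Tc_def Ew_split[OF S.spec_words[OF x]] by (simp add: sum_nonneg)
      finally show "q \<le> S.Tc (\<lambda>x v m. of_bool (x = one)) x v m" .
    qed
    also have "\<dots> = (S.Tc ^^ N) (\<lambda>x v m. of_bool (x = one)) one (\<lambda>_. 0) 0"
      unfolding N by (simp only: funpow_Suc_right comp_apply)
    finally show ?thesis .
  qed
  define N1 where "N1 = nat \<lceil>(4 + 128 * (A' + 1)) / \<theta>\<rceil> + 1"
  (* The bracket is a lower bound for the indicator of the good event: home, small sums, many special
     blocks. *)
  have main: "e ^ 2 / N * ((S.Tc ^^ N) (\<lambda>x v m. of_bool (x = one)) one (\<lambda>_. 0) 0
      + (- (1 / (A * N)) * (S.Tc ^^ N) (\<lambda>x v m. Sq v) one (\<lambda>_. 0) 0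
      + (- 1) * (S.Tc ^^ N) (\<lambda>x v m. of_bool (real m < \<theta> * real N)) one (\<lambda>_. 0) 0))
    \<le> (S.T ^^ N) G one (\<lambda>_. 0)" if N: "N1 \<le> N" for N
  proof -
    have N0: "0 < real N" using N by (simp add: N1_def)
    have "(4 + 128 * (A' + 1)) / \<theta> \<le> N"
      using N real_nat_ceiling_ge[of "(4 + 128 * (A' + 1)) / \<theta>"] unfolding N1_def by linarith
    then have Nbig: "4 + 128 * (A' + 1) \<le> \<theta> * N" using \<theta> by (simp add: field_simps)
    (* The parity conditions on the centred process; the last conjunct gives m \<le> N at the end. *)
    define Inv where "Inv = (\<lambda>i (x :: nat \<Rightarrow> int) v m. even (v l + int m) \<and>
        4 dvd v k + 2 * int m - 1 + x (Suc k) \<and> m + i \<le> N)"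
    have "(S.Tc ^^ N) (\<lambda>x v m. e ^ 2 / N * (of_bool (x = one) + (- (1 / (A * N)) * Sq v + (- 1) * of_bool (real m < \<theta> * real N)))) one (\<lambda>_. 0) 0
      \<le> (S.Tc ^^ N) (\<lambda>x v m. (S.Av ^^ m) G x v) one (\<lambda>_. 0) 0"
    proof (rule S.Tc_pow_mono[where Inv = Inv, OF _ _ _ one_states])
      show "Inv N one (\<lambda>_. 0) 0" by (simp add: Inv_def)
    next
      fix i x v m u assume inv: "Inv (Suc i) x v m" and x: "x \<in> states l" and u: "u \<in> words L"
      have inv4: "4 dvd v k + 2 * int m - 1 + x (Suc k)" using inv by (simp add: Inv_def)
      have Lev: "even (int L)" using L(1) by auto
      have par: "even (D x u l)" "4 dvd D x u k - x (Suc k) + run l x u (Suc k)"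
      proof -
        show "even (D x u l)" using ssum_parity[OF x u, of l] Lev by (simp add: D_def)
        have "4 dvd int L" using L(1) by presburger
        with ssum_mod4[OF x u kl] have "4 dvd ssum l k x u - int L - x (Suc k) + run l x u (Suc k) + int L"
          by (rule dvd_add)
        then show "4 dvd D x u k - x (Suc k) + run l x u (Suc k)" by (simp add: D_def algebra_simps)
      qed
      show "Inv i (run l x u) (\<lambda>j. v j + S.Dc x u j) (if u \<in> S.spec x then Suc m else m)"
      proof (cases "u \<in> S.spec x")
        case False
        have "4 dvd (v k + 2 * int m - 1 + x (Suc k)) + (D x u k - x (Suc k) + run l x u (Suc k))"
          by (rule dvd_add[OF inv4 par(2)])
        then show ?thesis using inv par(1) False by (simp add: Inv_def S.Dc_def algebra_simps)
      next
        case True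
        then obtain o1 where o1: "o1 \<in> Offs" "u = sp x o1" unfolding S.spec_def by blast
        then obtain a b where ab: "o1 = off2 k l a b" "a = 1 \<or> a = -1" "b = 1 \<or> b = -1" unfolding Offs_def by blast
        have "D x u = (\<lambda>j. c x j + o1 j)" using S.sp_D[OF x o1(1)] o1(2) by simp
        then have c: "c x k = D x u k - 2 * a" "c x l = D x u l - b"
          using off[of a b] ab(1) by simp_all
        have "4 dvd (v k + 2 * int m - 1 + x (Suc k)) + (D x u k - x (Suc k) + run l x u (Suc k)) + (2 - 2 * a)"
          by (rule dvd_add[OF dvd_add[OF inv4 par(2)]]) (use ab(2) in auto)
        also have "\<dots> = v k + c x k + 2 * int (Suc m) - 1 + run l x u (Suc k)" by (simp add: c)
        finally have "4 dvd v k + c x k + 2 * int (Suc m) - 1 + run l x u (Suc k)" .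
        moreover have "even (v l + c x l + int (Suc m))"
          using inv par(1) ab(3) by (auto simp: Inv_def c)
        moreover have "Suc m + i \<le> N" using inv by (simp add: Inv_def)
        ultimately show ?thesis using True by (simp only: Inv_def S.Dc_def if_True)
      qed
    next
      fix x v m assume inv: "Inv 0 x v m" and x: "x \<in> states l"
      let ?lhs = "e ^ 2 / N * (of_bool (x = one) + (- (1 / (A * N)) * Sq v + (- 1) * of_bool (real m < \<theta> * real N)))"
      have Sq0: "0 \<le> Sq v" by (simp add: Sq_def)
      show "?lhs \<le> (S.Av ^^ m) G x v"
      proof (cases "x = one \<and> Sq v \<le> A * N \<and> \<theta> * real N \<le> real m")
        case False
        have "of_bool (x = one) + (- (1 / (A * N)) * Sq v + (- 1) * of_bool (real m < \<theta> * real N)) \<le> (0::real)"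
        proof (cases "x = one \<and> \<theta> * real N \<le> real m")
          case True
          then have "A * N < Sq v" using False by auto
          then show ?thesis using True A N0 by (simp add: field_simps)
        next
          case False
          moreover have "0 \<le> 1 / (A * N) * Sq v" using A Sq0 by simp
          ultimately show ?thesis by auto
        qed
        then have "?lhs \<le> 0" using N0 by (intro mult_nonneg_nonpos) auto
        moreover have "0 \<le> (S.Av ^^ m) G x v" unfolding AvG by (simp add: rw2_nonneg rw_nonneg)
        ultimately show ?thesis by linarith
      next
        case True
        have m: "m \<le> N" using inv by (simp add: Inv_def)
        have mth: "\<theta> * N \<le> m" using True by simp
        have mb: "4 \<le> m" "128 * (A' + 1) \<le> m" using Nbig mth A by auto
        have "A * N = A' * (\<theta> * N)" using \<theta> by (simp add: A'_def)
        also have "\<dots> \<le> A' * m" using mth A by (intro mult_left_mono) auto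
        finally have sq: "Sq v \<le> A' * m" using True by linarith
        have root: "e / sqrt N \<le> exp (- 8 * (A' + 1)) / (2 * sqrt m)"
          unfolding e_def using m mb by (simp add: frac_le)
        have "even (v l + int m)" using inv by (simp add: Inv_def)
        moreover have "real_of_int ((v l) ^ 2) \<le> A' * m" using sq by (simp add: Sq_def) (smt (verit) zero_le_power2)
        ultimately have "exp (- 8 * (A' + 1)) / (2 * sqrt m) \<le> rw m (v l)"
          using A mb by (intro rw_lower) (auto simp: add.commute)
        then have r1: "e / sqrt N \<le> rw m (v l)" using root by linarith
        have "4 dvd v k + 2 * int m" using inv True by (simp add: Inv_def)
        then obtain t where t: "v k + 2 * int m = 4 * t" by blast
        then have ev: "v k = 2 * (2 * t - int m)" by simp
        have "(real_of_int (2 * t - int m)) ^ 2 \<le> (real_of_int (v k)) ^ 2"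
          unfolding ev of_int_mult power_mult_distrib using zero_le_power2[of "real_of_int (2 * t - int m)"] by simp
        then have "real_of_int ((2 * t - int m) ^ 2) \<le> A' * m"
          using sq by (simp add: Sq_def) (smt (verit) zero_le_power2)
        then have "exp (- 8 * (A' + 1)) / (2 * sqrt m) \<le> rw m (2 * t - int m)"
          using A mb by (intro rw_lower) auto
        then have r2: "e / sqrt N \<le> rw2 m (v k)" using root unfolding rw2_def ev by simp
        have "?lhs \<le> e ^ 2 / N * 1"
          using Sq0 A N0 True by (intro mult_left_mono) auto
        also have "\<dots> = (e / sqrt N) * (e / sqrt N)" using N0 by (simp add: power2_eq_square)
        also have "\<dots> \<le> rw2 m (v k) * rw m (v l)"
          using r1 r2 e by (intro mult_mono) (auto intro: rw2_nonneg)
        finally show ?thesis unfolding AvG using True by simp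
      qed
    qed
    then show ?thesis unfolding S.T_pow_eq[OF one_states] S.Tc_pow_add S.Tc_pow_cmult .
  qed
  have "(\<lambda>n. \<rho> ^ n) \<longlonglongrightarrow> 0" using \<theta> by (intro LIMSEQ_realpow_zero) auto
  then have "eventually (\<lambda>n. \<rho> ^ n < q / 4) sequentially" using q by (intro order_tendstoD(2)) auto
  then obtain N2 where N2: "\<And>n. N2 \<le> n \<Longrightarrow> \<rho> ^ n < q / 4" unfolding eventually_sequentially by auto
  have "e ^ 2 * (q / 2) / real N
    \<le> Ew (N * L) (\<lambda>u. of_bool (run l one u = one \<and> ssum l k one u = 0 \<and> ssum l l one u = 0))"
    if N: "N1 + N2 \<le> N" for N
  proof -
    have N0: "0 < real N" "1 \<le> N" using N by (simp_all add: N1_def)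
    let ?h = "(S.Tc ^^ N) (\<lambda>x v m. of_bool (x = one)) one (\<lambda>_. 0) 0 :: real"
    let ?s = "(S.Tc ^^ N) (\<lambda>x v m. Sq v) one (\<lambda>_. 0) 0"
    let ?f = "(S.Tc ^^ N) (\<lambda>x v m. of_bool (real m < \<theta> * real N)) one (\<lambda>_. 0) 0 :: real"
    have "1 / (A * N) * ?s \<le> 1 / (A * N) * (B * (N * L))"
      using second[of N] A N0 by (intro mult_left_mono) auto
    also have "\<dots> = q / 4" using N0 B L q by (simp add: A_def)
    finally have s: "1 / (A * N) * ?s \<le> q / 4" .
    have f: "?f \<le> q / 4" using few[rule_format, OF one_states, of N "\<lambda>_. 0"] N2[of N] N by linarith
    have "q / 2 \<le> ?h + (- (1 / (A * N)) * ?s + (- 1) * ?f)" using home[OF N0(2)] s f by linarith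
    then have "e ^ 2 / N * (q / 2) \<le> e ^ 2 / N * (?h + (- (1 / (A * N)) * ?s + (- 1) * ?f))"
      by (intro mult_left_mono) auto
    also have "\<dots> \<le> (S.T ^^ N) G one (\<lambda>_. 0)" by (rule main) (use N in simp)
    also have "\<dots> = Ew (N * L) (\<lambda>u. of_bool (run l one u = one \<and> ssum l k one u = 0 \<and> ssum l l one u = 0))"
      unfolding TE by (simp add: G_def D_def)
    finally show ?thesis by simp
  qed
  then show ?thesis using L e q by (intro exI[of _ L] exI[of _ "e ^ 2 * (q / 2)"] exI[of _ "N1 + N2"]) auto
qed

section \<open>Renewal argument\<close>

lemma at_most_one_last_visit:
  fixes P :: "nat \<Rightarrow> bool"
  shows "(\<Sum>n\<le>N. of_bool (P n \<and> (\<forall>i\<in>{n<..N}. \<not> P i))) \<le> (1::real)"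
proof (cases "\<exists>n\<le>N. P n")
  case True
  define n0 where "n0 = Max {n. n \<le> N \<and> P n}"
  have fin: "finite {n. n \<le> N \<and> P n}" by simp
  have n0: "n0 \<le> N" "P n0" using Max_in[OF fin] True by (auto simp: n0_def)
  have "n = n0" if "n \<le> N" "P n" "\<forall>i\<in>{n<..N}. \<not> P i" for n
  proof (rule antisym)
    show "n \<le> n0" using Max_ge[OF fin, of n] that by (simp add: n0_def)
    show "n0 \<le> n" using that n0 by force
  qed
  then have "(\<Sum>n\<le>N. of_bool (P n \<and> (\<forall>i\<in>{n<..N}. \<not> P i))) \<le> (\<Sum>n\<le>N. if n = n0 then 1 else (0::real))"
    by (intro sum_mono) auto
  then show ?thesis using n0 by simp
qed (auto simp: sum.neutral)

text \<open>The probability that the event \<open>V\<close> does not occur at any of the times \<open>1, \<dots>, m\<close>.\<close>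

definition escape :: "(int list \<Rightarrow> bool) \<Rightarrow> nat \<Rightarrow> real" where
  "escape V m = Ew m (\<lambda>w. of_bool (\<forall>i\<in>{1..m}. \<not> V (take i w)))"

text \<open>The regeneration property says that after an occurrence of \<open>V\<close> the further occurrences are those
of a fresh path.\<close>

lemma last_visit_prob:
  assumes regen: "\<And>u w. V u \<Longrightarrow> V (u @ w) \<longleftrightarrow> V w"
  shows "Ew (n + m) (\<lambda>u. of_bool (V (take n u) \<and> (\<forall>i\<in>{n<..n + m}. \<not> V (take i u))))
    = Ew n (\<lambda>u. of_bool (V u)) * escape V m"
proof -
  have "Ew (n + m) (\<lambda>u. of_bool (V (take n u) \<and> (\<forall>i\<in>{n<..n + m}. \<not> V (take i u))))
      = Ew n (\<lambda>u. Ew m (\<lambda>w. of_bool (V u) * of_bool (\<forall>i\<in>{1..m}. \<not> V (take i w))))"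
    unfolding Ew_append
  proof (intro Ew_cong)
    fix u w assume u: "u \<in> words n" "w \<in> words m"
    have len: "length u = n" using u by (simp add: words_def)
    have "(\<forall>i\<in>{n<..n + m}. \<not> V (take i (u @ w))) \<longleftrightarrow> (\<forall>i\<in>{1..m}. \<not> V (u @ take i w))"
    proof (intro iffI ballI)
      fix i assume *: "\<forall>i\<in>{n<..n + m}. \<not> V (take i (u @ w))" "i \<in> {1..m}"
      then show "\<not> V (u @ take i w)" using *(1)[rule_format, of "n + i"] len by auto
    next
      fix i assume *: "\<forall>i\<in>{1..m}. \<not> V (u @ take i w)" "i \<in> {n<..n + m}"
      then have "i - n \<in> {1..m}" by auto
      then have "\<not> V (u @ take (i - n) w)" using *(1) by blast
      then show "\<not> V (take i (u @ w))" using len *(2) by simp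
    qed
    then show "of_bool (V (take n (u @ w)) \<and> (\<forall>i\<in>{n<..n + m}. \<not> V (take i (u @ w))))
        = of_bool (V u) * (of_bool (\<forall>i\<in>{1..m}. \<not> V (take i w)) :: real)"
      using regen[of u] len by auto
  qed
  also have "\<dots> = Ew n (\<lambda>u. of_bool (V u)) * escape V m"
    by (simp only: Ew_cmult escape_def[symmetric] mult.commute[of _ "escape V m"])
  finally show ?thesis .
qed

lemma escape_nonneg: "0 \<le> escape V m"
  unfolding escape_def by (intro Ew_nonneg) auto

text \<open>At most one time up to \<open>N\<close> is the last occurrence of \<open>V\<close> up to \<open>N\<close>. Summing the probabilities of
these disjoint events, each of which is the probability of an occurrence times that of no further
one, shows that a positive lower bound for the latter bounds the expected number of occurrences.\<close>

lemma escape_arbitrarily_small: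
  assumes regen: "\<And>u w. V u \<Longrightarrow> V (u @ w) \<longleftrightarrow> V w"
    and div: "\<not> summable (\<lambda>n. Ew n (\<lambda>u. of_bool (V u)))" and e: "0 < e"
  shows "\<exists>m. escape V m < e"
proof (rule ccontr)
  assume "\<nexists>m. escape V m < e"
  then have ge: "e \<le> escape V m" for m by (simp add: not_less)
  let ?u = "\<lambda>n. Ew n (\<lambda>u. of_bool (V u)) :: real"
  have u0: "0 \<le> ?u n" for n by (intro Ew_nonneg) auto
  have bound: "(\<Sum>n\<le>N. ?u n) \<le> 1 / e" for N
  proof -
    have "(\<Sum>n\<le>N. ?u n) * e \<le> (\<Sum>n\<le>N. ?u n * escape V (N - n))"
      unfolding sum_distrib_right by (intro sum_mono mult_left_mono ge u0)
    also have "\<dots> = (\<Sum>n\<le>N. Ew N (\<lambda>u. of_bool (V (take n u) \<and> (\<forall>i\<in>{n<..N}. \<not> V (take i u)))))"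
    proof (intro sum.cong refl)
      fix n assume "n \<in> {..N}"
      then have "n + (N - n) = N" by simp
      then show "?u n * escape V (N - n) = Ew N (\<lambda>u. of_bool (V (take n u) \<and> (\<forall>i\<in>{n<..N}. \<not> V (take i u))))"
        using last_visit_prob[OF regen, of n "N - n"] by simp
    qed
    also have "\<dots> = Ew N (\<lambda>u. \<Sum>n\<le>N. of_bool (V (take n u) \<and> (\<forall>i\<in>{n<..N}. \<not> V (take i u))))"
      by (rule Ew_sum[symmetric])
    also have "\<dots> \<le> Ew N (\<lambda>u. 1)" by (intro Ew_mono at_most_one_last_visit)
    finally show ?thesis using e by (simp add: field_simps)
  qed
  have "summable ?u"
  proof (rule bounded_imp_summable)
    show "(\<Sum>n\<le>N. ?u n) \<le> 1 / e" for N by (rule bound)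
  qed (rule u0)
  then show False using div by simp
qed

lemma return_probability_not_summable:
  assumes kl: "1 \<le> k" "k < l"
  shows "\<not> summable (\<lambda>n. Ew n (\<lambda>u. of_bool (run l one u = one \<and> ssum l k one u = 0 \<and> ssum l l one u = 0)))"
    (is "\<not> summable ?u")
proof
  assume sum: "summable ?u"
  obtain L c N0 where L: "0 < L" and c: "0 < c" and le: "\<forall>N\<ge>N0. c / real N \<le> ?u (N * L)"
    using return_probability_lower_bound[OF kl] by (elim exE conjE)
  have u0: "0 \<le> ?u n" for n by (intro Ew_nonneg) auto
  have "summable (?u \<circ> (\<lambda>N. N * L))"
    by (rule summable_reindex[OF sum]) (use L u0 in \<open>auto simp: inj_on_def\<close>)
  then have "summable (\<lambda>N. c / real N)"
    by (rule summable_comparison_test'[where N = N0]) (use le c in auto)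
  then have "summable (\<lambda>N. (1 / c) * (c / real N))" by (rule summable_mult)
  then have "summable (\<lambda>N. 1 / real N)" using c by simp
  then show False using not_summable_harmonic[where 'a = real] by (simp add: inverse_eq_divide)
qed

end

section \<open>The array as a function of the path\<close>

text \<open>List positions start at \<open>0\<close>, whereas the array reads its signs from index \<open>1\<close> on.\<close>

abbreviation seq :: "int list \<Rightarrow> nat \<Rightarrow> int" where "seq u \<equiv> (\<lambda>i. u ! (i - 1))"

lemma eta_cong: "(\<And>i. i \<in> {1..n} \<Longrightarrow> x i = y i) \<Longrightarrow> eta x k n = eta y k n"
proof (induction x k n rule: eta.induct)
  case (1 x k n)
  consider "n = 0 \<or> k = 0" | "n \<noteq> 0" "k > 0" | "n \<noteq> 0" "k < 0" by linarith
  then show ?case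
  proof cases
    case 1
    then show ?thesis using "1.prems" by (auto simp: eta.simps[of x k n] eta.simps[of y k n])
  next
    case 2
    have "eta x (k - 1) m = eta y (k - 1) m" if m: "m \<in> {1..n}" for m
      by (rule "1.IH"(1), use 2 m in simp, use 2 in simp, use 2 in simp, rule m, rule "1.prems", use m in auto)
    then have "(\<Prod>m = 1..n. eta x (k - 1) m) = (\<Prod>m = 1..n. eta y (k - 1) m)" by (rule prod.cong[OF refl])
    then show ?thesis using 2 by (simp add: eta.simps[of x k n] eta.simps[of y k n])
  next
    case 3
    then have k: "\<not> n = 0" "\<not> k = 0" "\<not> 0 < k" by auto
    have "eta x (k + 1) (n - 1) = eta y (k + 1) (n - 1)" by (rule "1.IH"(2)[OF k], rule "1.prems") auto
    moreover have "eta x (k + 1) n = eta y (k + 1) n" by (rule "1.IH"(3)[OF k], rule "1.prems") auto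
    ultimately show ?thesis using 3 by (simp add: eta.simps[of x k n] eta.simps[of y k n])
  qed
qed

lemma eta_sign: "(\<And>i. i \<in> {1..n} \<Longrightarrow> x i \<in> {1, -1}) \<Longrightarrow> eta x k n \<in> {1, -1}"
proof (induction x k n rule: eta.induct)
  case (1 x k n)
  consider "n = 0" | "n \<noteq> 0" "k = 0" | "n \<noteq> 0" "k > 0" | "n \<noteq> 0" "k < 0" by linarith
  then show ?case
  proof cases
    case 3
    then have "(\<Prod>m = 1..n. eta x (k - 1) m) \<in> {1, -1}"
      using 1 by (intro sign_prod) auto
    then show ?thesis using 3 by (subst eta.simps) simp
  next
    case 4
    have k: "\<not> n = 0" "\<not> k = 0" "\<not> 0 < k" using 4 by auto
    have "eta x (k + 1) (n - 1) \<in> {1, -1}" by (rule 1(2)[OF k], rule 1(4)) auto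
    moreover have "eta x (k + 1) n \<in> {1, -1}" by (rule 1(3)[OF k], rule 1(4)) auto
    ultimately have "eta x (k + 1) (n - 1) * eta x (k + 1) n \<in> {1, -1}"
      by (rule sign_mult)
    then show ?thesis using 4 by (subst eta.simps) simp
  next
    case 2
    then show ?thesis using "1.prems"[of n] by (simp add: eta_zero)
  qed simp
qed

lemma S_cong: "(\<And>i. i \<in> {1..n} \<Longrightarrow> x i = y i) \<Longrightarrow> S x k n = S y k n"
  unfolding S_def by (intro sum.cong refl eta_cong) auto

lemma S_increment:
  assumes "\<And>i. 1 \<le> i \<Longrightarrow> x i \<in> {1, -1}" "m \<le> n"
  shows "\<bar>S x k n - S x k m\<bar> \<le> int (n - m)"
proof -
  have "S x k n = S x k m + (\<Sum>i\<in>{m<..n}. eta x k i)"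
  proof -
    have "{1..n} = {1..m} \<union> {m<..n}" "{1..m} \<inter> {m<..n} = {}" using assms(2) by auto
    then show ?thesis unfolding S_def by (metis sum.union_disjoint finite_atLeastAtMost finite_greaterThanAtMost)
  qed
  moreover have "\<bar>\<Sum>i\<in>{m<..n}. eta x k i\<bar> \<le> (\<Sum>i\<in>{m<..n}. 1)"
  proof (rule order_trans[OF sum_abs], rule sum_mono)
    fix i
    have "eta x k i \<in> {1, -1}" by (rule eta_sign) (use assms(1) in auto)
    then show "\<bar>eta x k i\<bar> \<le> 1" by auto
  qed
  ultimately show ?thesis by simp
qed

text \<open>Pascal's rule: passing to the next lower level multiplies two consecutive monomials.\<close>

lemma eta_neg:
  assumes "j < n"
  shows "eta x (- int j) n = (\<Prod>i\<le>j. x (n - i) ^ (j choose i))"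
  using assms
proof (induction j arbitrary: n)
  case 0
  then show ?case by (simp add: eta_zero)
next
  case (Suc j)
  have "eta x (- int (Suc j)) n = eta x (- int j) (n - 1) * eta x (- int j) n"
    using eta_down[of "int (Suc j)" n x] Suc.prems by simp
  also have "\<dots> = (\<Prod>i\<le>j. x (n - 1 - i) ^ (j choose i)) * (\<Prod>i\<le>j. x (n - i) ^ (j choose i))"
    using Suc.IH[of "n - 1"] Suc.IH[of n] Suc.prems by simp
  also have "(\<Prod>i\<le>j. x (n - i) ^ (j choose i)) = (\<Prod>i\<le>Suc j. x (n - i) ^ (j choose i))"
    by (simp add: binomial_eq_0)
  also have "\<dots> = x n * (\<Prod>i\<le>j. x (n - Suc i) ^ (j choose Suc i))"
    by (subst prod.atMost_Suc_shift) simp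
  also have "(\<Prod>i\<le>j. x (n - 1 - i) ^ (j choose i)) * (x n * (\<Prod>i\<le>j. x (n - Suc i) ^ (j choose Suc i)))
      = x n * (\<Prod>i\<le>j. x (n - Suc i) ^ (Suc j choose Suc i))"
    by (simp add: power_add prod.distrib mult_ac)
  also have "\<dots> = (\<Prod>i\<le>Suc j. x (n - i) ^ (Suc j choose i))"
    by (subst prod.atMost_Suc_shift) simp
  finally show ?case .
qed

lemma run_word:
  assumes "j \<in> {1..K}"
  shows "run K one (map (\<lambda>i. x (Suc i)) [0..<n]) j = eta x (int j) n"
  using assms
proof (induction n arbitrary: j)
  case (Suc n)
  let ?w = "map (\<lambda>i. x (Suc i)) [0..<n]"
  have e: "eta x (int j) (Suc n) = x (Suc n) * (\<Prod>i=1..j. eta x (int i) n)" for j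
  proof (induction j)
    case 0
    then show ?case by (simp add: eta_zero)
  next
    case (Suc j)
    have "eta x (int (Suc j)) (Suc n) = eta x (int (Suc j)) n * eta x (int j) (Suc n)"
      using eta_up[of "int j" x n] eta_up[of "int j" x "Suc n"] by (simp add: add.commute)
    then show ?case using Suc by simp
  qed
  have "run K one (map (\<lambda>i. x (Suc i)) [0..<Suc n]) j = step K (run K one ?w) (x (Suc n)) j"
    by (simp add: run_append)
  also have "\<dots> = x (Suc n) * (\<Prod>i=1..j. run K one ?w i)"
    using Suc.prems by (simp add: step_def)
  also have "(\<Prod>i=1..j. run K one ?w i) = (\<Prod>i=1..j. eta x (int i) n)"
    using Suc by (intro prod.cong) auto
  finally show ?case using e[of j] by simp
qed simp

lemma ssum_word:
  assumes "j \<in> {1..K}"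
  shows "ssum K j one (map (\<lambda>i. x (Suc i)) [0..<n]) = S x (int j) n"
proof (induction n)
  case (Suc n)
  have "run K one (map (\<lambda>i. x (Suc i)) [0..<Suc n]) j = step K (run K one (map (\<lambda>i. x (Suc i)) [0..<n])) (x (Suc n)) j"
    by (simp add: run_append)
  then show ?case using Suc run_word[OF assms, of x "Suc n"] by (simp add: ssum_append S_def)
qed (simp add: S_def)

section \<open>Levels at most zero\<close>

context coin
begin

text \<open>The expectation of the \<open>a\<close>-th power of a sign. If \<open>p \<noteq> 1/2\<close>, it is nonzero for all \<open>a\<close>.\<close>

definition moment :: "nat \<Rightarrow> real" where "moment a = p + (1 - p) * (-1) ^ a"

lemma moment_0 [simp]: "moment 0 = 1" by (simp add: moment_def)

lemma abs_moment: "\<bar>moment a\<bar> \<le> 1"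
  using p_pos p_less_1 by (cases "even a") (auto simp: moment_def)

lemma moment_nonzero: "p \<noteq> 1/2 \<Longrightarrow> moment a \<noteq> 0"
  by (cases "even a") (auto simp: moment_def)

lemma Ew_monomial: "Ew n (\<lambda>u. \<Prod>t<n. real_of_int (u ! t) ^ a t) = (\<Prod>t<n. moment (a t))"
proof (induction n arbitrary: a)
  case (Suc n)
  show ?case
    unfolding Ew_Suc prod.lessThan_Suc_shift
    using Suc[of "\<lambda>t. a (Suc t)"] by (simp add: Ew_cmult moment_def algebra_simps)
qed simp

text \<open>The common expectation of the entries of level \<open>- j\<close>, from index \<open>j + 1\<close> on.\<close>

definition eta_mean :: "nat \<Rightarrow> real" where "eta_mean j = (\<Prod>i\<le>j. moment (j choose i))"

lemma abs_eta_mean: "\<bar>eta_mean j\<bar> \<le> 1"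
  unfolding eta_mean_def abs_prod using abs_moment by (intro prod_le_1) auto

lemma eta_mean_nonzero: "p \<noteq> 1/2 \<Longrightarrow> eta_mean j \<noteq> 0"
  using moment_nonzero by (simp add: eta_mean_def)

text \<open>For \<open>j < d\<close> the entry with index \<open>m + d\<close> of level \<open>- j\<close> is a monomial in the letters after the first
\<open>m\<close>, so its conditional expectation does not depend on the first \<open>m\<close> letters.\<close>

lemma mean_eta_neg:
  assumes u: "length u = m" and d: "j < d" "d \<le> r"
  shows "Ew r (\<lambda>w. real_of_int (eta (seq (u @ w)) (- int j) (m + d))) = eta_mean j"
proof -
  define a where "a = (\<lambda>t. if t < d then j choose (d - Suc t) else 0)"
  have cut: "(\<Prod>t<r. f t (a t)) = (\<Prod>i\<le>j. f (d - Suc i) (j choose i))"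
    if f0: "\<And>t. f t 0 = 1" for f :: "nat \<Rightarrow> nat \<Rightarrow> real"
  proof -
    have "(\<Prod>t<r. f t (a t)) = (\<Prod>t<d. f t (a t))"
      by (rule prod.mono_neutral_right) (use d f0 in \<open>auto simp: a_def\<close>)
    also have "\<dots> = (\<Prod>t<d. f (d - Suc t) (a (d - Suc t)))"
      by (rule prod.nat_diff_reindex[symmetric])
    also have "\<dots> = (\<Prod>t<d. f (d - Suc t) (j choose t))"
      by (intro prod.cong) (auto simp: a_def)
    also have "\<dots> = (\<Prod>t\<le>j. f (d - Suc t) (j choose t))"
      by (rule prod.mono_neutral_right) (use d f0 in \<open>auto simp: binomial_eq_0\<close>)
    finally show ?thesis .
  qed
  have "Ew r (\<lambda>w. real_of_int (eta (seq (u @ w)) (- int j) (m + d))) = Ew r (\<lambda>w. \<Prod>t<r. real_of_int (w ! t) ^ a t)"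
  proof (rule Ew_cong)
    fix w assume "w \<in> words r"
    have "eta (seq (u @ w)) (- int j) (m + d) = (\<Prod>i\<le>j. (seq (u @ w)) (m + d - i) ^ (j choose i))"
      by (rule eta_neg) (use d in simp)
    also have "\<dots> = (\<Prod>i\<le>j. (w ! (d - Suc i)) ^ (j choose i))"
    proof (intro prod.cong refl)
      fix i assume "i \<in> {..j}"
      then have "m + d - i - 1 = m + (d - Suc i)" using d by simp
      then have "seq (u @ w) (m + d - i) = (u @ w) ! (m + (d - Suc i))" by (simp only:)
      then show "seq (u @ w) (m + d - i) ^ (j choose i) = w ! (d - Suc i) ^ (j choose i)"
        using u by (simp add: nth_append)
    qed
    finally show "real_of_int (eta (seq (u @ w)) (- int j) (m + d)) = (\<Prod>t<r. real_of_int (w ! t) ^ a t)"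
      using cut[of "\<lambda>t b. real_of_int (w ! t) ^ b"] by simp
  qed
  also have "\<dots> = eta_mean j"
    unfolding Ew_monomial eta_mean_def using cut[of "\<lambda>t. moment"] by simp
  finally show ?thesis .
qed

abbreviation dev :: "nat \<Rightarrow> nat \<Rightarrow> int list \<Rightarrow> real" where
  "dev j m u \<equiv> real_of_int (eta (seq u) (- int j) m) - eta_mean j"

lemma covariance_neg_zero:
  assumes "m + j < m'" "m' \<le> n"
  shows "Ew n (\<lambda>u. dev j m u * dev j m' u) = 0"
proof -
  obtain d where d: "m' = m + d" using assms(1) le_Suc_ex[of m m'] by auto
  obtain r where n: "n = m + r" using assms le_Suc_ex[of m n] by auto
  have "Ew n (\<lambda>u. dev j m u * dev j m' u) = Ew m (\<lambda>u. Ew r (\<lambda>w. dev j m u * dev j (m + d) (u @ w)))"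
    unfolding n Ew_append d
  proof (intro Ew_cong)
    fix u w assume "u \<in> words m"
    then have len: "length u = m" by (simp add: words_def)
    have "eta (seq (u @ w)) (- int j) m = eta (seq u) (- int j) m"
      by (rule eta_cong) (use len in \<open>auto simp: nth_append\<close>)
    then show "dev j m (u @ w) * dev j (m + d) (u @ w) = dev j m u * dev j (m + d) (u @ w)" by simp
  qed
  also have "\<dots> = Ew m (\<lambda>u. 0)"
  proof (rule Ew_cong)
    fix u assume "u \<in> words m"
    then have len: "length u = m" by (simp add: words_def)
    show "Ew r (\<lambda>w. dev j m u * dev j (m + d) (u @ w)) = 0"
      unfolding Ew_cmult Ew_diff using mean_eta_neg[OF len, of j d r] assms d n by simp
  qed
  finally show ?thesis by simp
qed

lemma dev_bound:
  assumes "u \<in> words n" "m \<le> n" shows "\<bar>dev j m u\<bar> \<le> 2"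
proof -
  have "seq u i \<in> {1, -1}" if "i \<in> {1..m}" for i
  proof -
    have "u ! (i - 1) \<in> set u" using assms that by (intro nth_mem) (auto simp: words_def)
    then show ?thesis using assms by (auto simp: words_def)
  qed
  then have "eta (seq u) (- int j) m \<in> {1, -1}" by (rule eta_sign)
  then show ?thesis using abs_eta_mean[of j] by auto
qed

text \<open>Only the at most \<open>2 * j + 1\<close> pairs of indices at distance at most \<open>j\<close> contribute for each \<open>m\<close>. The
first \<open>j\<close> entries may have other expectations, but \<open>covariance_neg_zero\<close> covers them as well, since only
the later factor has to be centred.\<close>

lemma variance_neg:
  "Ew n (\<lambda>u. (real_of_int (S (seq u) (- int j) n) - n * eta_mean j) ^ 2) \<le> 4 * (2 * real j + 1) * real n"
proof -
  have "Ew n (\<lambda>u. (real_of_int (S (seq u) (- int j) n) - n * eta_mean j) ^ 2)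
      = Ew n (\<lambda>u. \<Sum>m=1..n. \<Sum>m'=1..n. dev j m u * dev j m' u)"
  proof (rule Ew_cong)
    fix u
    have "real_of_int (S (seq u) (- int j) n) - n * eta_mean j = (\<Sum>m=1..n. dev j m u)"
      by (simp add: S_def sum_subtractf)
    then show "(real_of_int (S (seq u) (- int j) n) - n * eta_mean j) ^ 2 = (\<Sum>m=1..n. \<Sum>m'=1..n. dev j m u * dev j m' u)"
      by (simp add: power2_eq_square sum_product)
  qed
  also have "\<dots> = (\<Sum>m=1..n. \<Sum>m'=1..n. Ew n (\<lambda>u. dev j m u * dev j m' u))"
    by (simp only: Ew_sum)
  also have "\<dots> \<le> (\<Sum>m=1..n. 4 * (2 * real j + 1))"
  proof (rule sum_mono)
    fix m assume m: "m \<in> {1..n}"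
    have "(\<Sum>m'=1..n. Ew n (\<lambda>u. dev j m u * dev j m' u)) \<le> (\<Sum>m'=1..n. if m' \<in> {m - j..m + j} then 4 else 0)"
    proof (rule sum_mono)
      fix m' assume m': "m' \<in> {1..n}"
      show "Ew n (\<lambda>u. dev j m u * dev j m' u) \<le> (if m' \<in> {m - j..m + j} then 4 else 0)"
      proof (cases "m' \<in> {m - j..m + j}")
        case True
        have "\<bar>Ew n (\<lambda>u. dev j m u * dev j m' u)\<bar> \<le> 4"
        proof (rule Ew_abs_le)
          fix u assume "u \<in> words n"
          then have "\<bar>dev j m u\<bar> * \<bar>dev j m' u\<bar> \<le> 2 * 2"
            using dev_bound[of u n] m m' by (intro mult_mono) auto
          then show "\<bar>dev j m u * dev j m' u\<bar> \<le> 4" by (simp add: abs_mult)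
        qed
        then show ?thesis using True by simp
      next
        case False
        then consider "m + j < m'" | "m' + j < m" by fastforce
        then have "Ew n (\<lambda>u. dev j m u * dev j m' u) = 0"
        proof cases
          case 1 then show ?thesis using covariance_neg_zero m' by simp
        next
          case 2
          then have "Ew n (\<lambda>u. dev j m' u * dev j m u) = 0" using covariance_neg_zero m by simp
          then show ?thesis by (simp add: mult.commute)
        qed
        then show ?thesis using False by simp
      qed
    qed
    also have "\<dots> = (\<Sum>m'\<in>{1..n} \<inter> {m - j..m + j}. 4)" by (rule sum.inter_restrict[symmetric]) simp
    also have "\<dots> \<le> (\<Sum>m'\<in>{m - j..m + j}. 4)" by (rule sum_mono2) auto
    also have "\<dots> \<le> 4 * (2 * real j + 1)" by simp
    finally show "(\<Sum>m'=1..n. Ew n (\<lambda>u. dev j m u * dev j m' u)) \<le> 4 * (2 * real j + 1)" .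
  qed
  also have "\<dots> = 4 * (2 * real j + 1) * real n" by simp
  finally show ?thesis .
qed

text \<open>Chebyshev's inequality gives probabilities of order \<open>1 / n\<close>, which are summable along squares. Zeros
between two squares are covered as well: between \<open>N ^ 2\<close> and \<open>(N + 1) ^ 2\<close> the sum moves by at most
\<open>2 * N\<close>, so a zero there forces the sum at time \<open>N ^ 2\<close> to be at most \<open>2 * N\<close> in absolute value.\<close>

lemma near_zero_at_squares_summable:
  assumes "p \<noteq> 1/2"
  shows "summable (\<lambda>N. Ew (N ^ 2) (\<lambda>u. of_bool (\<bar>S (seq u) (- int j) (N ^ 2)\<bar> \<le> 2 * int N)))"
proof -
  define \<mu> where "\<mu> = \<bar>eta_mean j\<bar>"
  have \<mu>: "0 < \<mu>" using eta_mean_nonzero[OF assms] by (simp add: \<mu>_def)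
  define N0 where "N0 = nat \<lceil>4 / \<mu>\<rceil> + 1"
  have le: "Ew (N ^ 2) (\<lambda>u. of_bool (\<bar>S (seq u) (- int j) (N ^ 2)\<bar> \<le> 2 * int N))
      \<le> 16 * (2 * real j + 1) / \<mu> ^ 2 * inverse (real N ^ 2)" if N: "N0 \<le> N" for N
  proof -
    have "4 / \<mu> \<le> N" using N real_nat_ceiling_ge[of "4 / \<mu>"] unfolding N0_def by linarith
    then have N4: "4 \<le> \<mu> * N" using \<mu> by (simp add: field_simps)
    have Npos: "0 < real N" using N by (simp add: N0_def)
    let ?n = "N ^ 2" and ?b = "\<mu> * real N ^ 2 / 2"
    have b: "0 < ?b" using \<mu> Npos by simp
    have "2 * real N \<le> ?b"
      using mult_right_mono[OF N4, of "real N / 2"] by (simp add: power2_eq_square)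
    have "Ew ?n (\<lambda>u. of_bool (\<bar>S (seq u) (- int j) ?n\<bar> \<le> 2 * int N))
      \<le> Ew ?n (\<lambda>u. (1 / ?b ^ 2) * (real_of_int (S (seq u) (- int j) ?n) - ?n * eta_mean j) ^ 2)"
    proof (rule Ew_mono)
      fix u
      let ?s = "real_of_int (S (seq u) (- int j) ?n)"
      show "of_bool (\<bar>S (seq u) (- int j) ?n\<bar> \<le> 2 * int N) \<le> (1 / ?b ^ 2) * (?s - ?n * eta_mean j) ^ 2"
      proof (cases "\<bar>S (seq u) (- int j) ?n\<bar> \<le> 2 * int N")
        case True
        then have "\<bar>?s\<bar> \<le> 2 * real N" by linarith
        moreover have "\<bar>real ?n * eta_mean j\<bar> = 2 * ?b" by (simp add: abs_mult \<mu>_def)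
        ultimately have "?b \<le> \<bar>?s - ?n * eta_mean j\<bar>" using \<open>2 * real N \<le> ?b\<close> by linarith
        then have "?b ^ 2 \<le> \<bar>?s - ?n * eta_mean j\<bar> ^ 2" using b by (intro power_mono) auto
        then have "?b ^ 2 \<le> (?s - ?n * eta_mean j) ^ 2" by (simp only: power2_abs)
        then have "1 \<le> (?s - ?n * eta_mean j) ^ 2 / ?b ^ 2"
          by (simp only: le_divide_eq_1_pos[OF zero_less_power[OF b]])
        then show ?thesis using True by simp
      qed simp
    qed
    also have "\<dots> \<le> (1 / ?b ^ 2) * (4 * (2 * real j + 1) * real ?n)"
      unfolding Ew_cmult by (rule mult_left_mono[OF variance_neg]) simp
    also have "\<dots> = 16 * (2 * real j + 1) / \<mu> ^ 2 * inverse (real N ^ 2)"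
      using \<mu> Npos by (simp add: power_divide power_mult_distrib field_simps power2_eq_square)
    finally show ?thesis .
  qed
  have "summable (\<lambda>N. 16 * (2 * real j + 1) / \<mu> ^ 2 * inverse (real N ^ 2))"
    by (intro summable_mult inverse_power_summable) simp
  then show ?thesis
    by (rule summable_comparison_test'[where N = N0]) (use le Ew_nonneg in auto)
qed

end

section \<open>Almost sure statements\<close>

locale sign_process = coin p + prob_space M for p :: real and M :: "'a measure" +
  fixes \<xi> :: "nat \<Rightarrow> 'a \<Rightarrow> int"
  assumes indep: "indep_vars (\<lambda>_. count_space UNIV) \<xi> {1..}"
    and plus: "\<And>n. n \<ge> 1 \<Longrightarrow> prob {\<omega> \<in> space M. \<xi> n \<omega> = 1} = p"
    and minus: "\<And>n. n \<ge> 1 \<Longrightarrow> prob {\<omega> \<in> space M. \<xi> n \<omega> = -1} = 1 - p"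
begin

definition word :: "nat \<Rightarrow> 'a \<Rightarrow> int list" where
  "word n \<omega> = map (\<lambda>i. \<xi> (Suc i) \<omega>) [0..<n]"

lemma length_word [simp]: "length (word n \<omega>) = n"
  by (simp add: word_def)

lemma take_word: "i \<le> n \<Longrightarrow> take i (word n \<omega>) = word i \<omega>"
  by (simp add: word_def take_map)

lemma xi_measurable: "1 \<le> n \<Longrightarrow> \<xi> n \<in> measurable M (count_space UNIV)"
  using indep by (auto simp: indep_vars_def)

lemma word_cylinder:
  assumes "length u = n"
  shows "{\<omega> \<in> space M. word n \<omega> = u} = space M \<inter> (\<Inter>j\<in>{1..n}. \<xi> j -` {u ! (j - 1)} \<inter> space M)"
proof -
  have "word n \<omega> = u \<longleftrightarrow> (\<forall>j\<in>{1..n}. \<xi> j \<omega> = u ! (j - 1))" for \<omega>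
  proof -
    have "word n \<omega> = u \<longleftrightarrow> (\<forall>i<n. \<xi> (Suc i) \<omega> = u ! i)"
      using assms by (simp add: list_eq_iff_nth_eq word_def)
    also have "\<dots> \<longleftrightarrow> (\<forall>j\<in>{1..n}. \<xi> j \<omega> = u ! (j - 1))"
    proof (intro iffI ballI allI impI)
      fix j assume "\<forall>i<n. \<xi> (Suc i) \<omega> = u ! i" "j \<in> {1..n}"
      then show "\<xi> j \<omega> = u ! (j - 1)" by (cases j) auto
    next
      fix i assume "\<forall>j\<in>{1..n}. \<xi> j \<omega> = u ! (j - 1)" "i < n"
      then show "\<xi> (Suc i) \<omega> = u ! i" by (auto dest: bspec[of _ _ "Suc i"])
    qed
    finally show ?thesis .
  qed
  then show ?thesis by auto
qed

lemma word_measurable: "word n \<in> measurable M (count_space UNIV)"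
proof -
  have "word n -` {u} \<inter> space M \<in> sets M" for u
  proof (cases "length u = n")
    case True
    have "space M \<inter> (\<Inter>j\<in>{1..n}. \<xi> j -` {u ! (j - 1)} \<inter> space M) \<in> sets M"
    proof (cases "n = 0")
      case False
      then show ?thesis
        by (intro sets.Int sets.top sets.finite_INT measurable_sets[OF xi_measurable]) auto
    qed simp
    moreover have "word n -` {u} \<inter> space M = {\<omega> \<in> space M. word n \<omega> = u}" by auto
    ultimately show ?thesis using word_cylinder[OF True] by simp
  next
    case False
    then have "word n -` {u} \<inter> space M = {}" by auto
    then show ?thesis by simp
  qed
  then show ?thesis by (subst measurable_count_space_eq_countable) auto
qed

lemma word_event: "{\<omega> \<in> space M. Q (word n \<omega>)} \<in> events"
  using measurable_sets[OF word_measurable, of "{u. Q u}" n] by (simp add: vimage_def Int_def conj_commute)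

lemma prob_cylinder:
  assumes u: "u \<in> words n"
  shows "prob {\<omega> \<in> space M. word n \<omega> = u} = wt u"
proof (cases "n = 0")
  case True
  then show ?thesis using u prob_space by (simp add: word_def)
next
  case False
  have len: "length u = n" using u by (simp add: words_def)
  have "prob {\<omega> \<in> space M. word n \<omega> = u} = prob (\<Inter>j\<in>{1..n}. \<xi> j -` {u ! (j - 1)} \<inter> space M)"
    unfolding word_cylinder[OF len] using False by (intro arg_cong[where f = prob]) auto
  also have "\<dots> = (\<Prod>j\<in>{1..n}. prob (\<xi> j -` {u ! (j - 1)} \<inter> space M))"
    by (rule indep_varsD[OF indep]) (use False in auto)
  also have "\<dots> = (\<Prod>j\<in>{1..n}. if u ! (j - 1) = 1 then p else 1 - p)"
  proof (intro prod.cong refl)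
    fix j assume j: "j \<in> {1..n}"
    then have "u ! (j - 1) \<in> set u" using len by (intro nth_mem) auto
    then have "u ! (j - 1) \<in> {1, -1}" using u by (auto simp: words_def)
    moreover have "\<xi> j -` {b} \<inter> space M = {\<omega> \<in> space M. \<xi> j \<omega> = b}" for b by auto
    ultimately show "prob (\<xi> j -` {u ! (j - 1)} \<inter> space M) = (if u ! (j - 1) = 1 then p else 1 - p)"
      using plus[of j] minus[of j] j by auto
  qed
  also have "\<dots> = (\<Prod>i<n. if u ! i = 1 then p else 1 - p)"
    by (rule prod.reindex_bij_witness[of _ Suc "\<lambda>j. j - 1"]) auto
  also have "\<dots> = wt u"
    unfolding wt_def using len by (simp add: prod.list_conv_set_nth atLeast0LessThan)
  finally show ?thesis .
qed

lemma prob_words_Collect: "prob {\<omega> \<in> space M. word n \<omega> \<in> words n \<and> Q (word n \<omega>)} = Ew n (\<lambda>u. of_bool (Q u))"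
proof -
  have "{\<omega> \<in> space M. word n \<omega> \<in> words n \<and> Q (word n \<omega>)} = (\<Union>u\<in>{u\<in>words n. Q u}. {\<omega> \<in> space M. word n \<omega> = u})"
    by auto
  also have "prob \<dots> = (\<Sum>u\<in>{u\<in>words n. Q u}. prob {\<omega> \<in> space M. word n \<omega> = u})"
    by (rule finite_measure_finite_Union)
      (auto simp: disjoint_family_on_def intro: word_event[of "\<lambda>v. v = _"])
  also have "\<dots> = (\<Sum>u\<in>{u\<in>words n. Q u}. wt u)"
    by (intro sum.cong) (auto simp: prob_cylinder)
  also have "\<dots> = Ew n (\<lambda>u. of_bool (Q u))"
    unfolding Ew_def by (simp add: sum.inter_filter if_distrib of_bool_def cong: if_cong)
  finally show ?thesis .
qed

lemma AE_word: "AE \<omega> in M. word n \<omega> \<in> words n"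
  using prob_words_Collect[of n "\<lambda>_. True"] word_event[of "\<lambda>u. u \<in> words n" n] by (simp add: prob_Collect_eq_1)

text \<open>The link between the measure space and the weighted words.\<close>

lemma prob_word: "prob {\<omega> \<in> space M. Q (word n \<omega>)} = Ew n (\<lambda>u. of_bool (Q u))"
  unfolding prob_words_Collect[symmetric]
  by (intro prob_eq_AE word_event) (use AE_word[of n] in auto)

lemma AE_signs: "AE \<omega> in M. \<forall>i\<ge>1. \<xi> i \<omega> \<in> {1, -1}"
proof -
  have "AE \<omega> in M. \<forall>n. word n \<omega> \<in> words n" using AE_word by (simp add: AE_all_countable)
  then show ?thesis
  proof (rule AE_mp, intro AE_I2 impI allI)
    fix \<omega> and i :: nat assume w: "\<forall>n. word n \<omega> \<in> words n" and i: "1 \<le> i"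
    have "\<xi> i \<omega> \<in> set (word i \<omega>)" using i by (cases i) (auto simp: word_def)
    then show "\<xi> i \<omega> \<in> {1, -1}" using w by (auto simp: words_def)
  qed
qed

lemma AE_finitely_often:
  assumes "summable (\<lambda>n. Ew (f n) (\<lambda>u. of_bool (Q n u)))"
  shows "AE \<omega> in M. finite {n. Q n (word (f n) \<omega>)}"
proof -
  have "AE \<omega> in M. eventually (\<lambda>n. \<omega> \<in> space M - {\<omega> \<in> space M. Q n (word (f n) \<omega>)}) sequentially"
    using assms by (intro borel_cantelli_AE1) (auto simp: word_event prob_word less_top[symmetric])
  then show ?thesis
  proof (rule AE_mp, intro AE_I2 impI)
    fix \<omega> assume "\<omega> \<in> space M" "eventually (\<lambda>n. \<omega> \<in> space M - {\<omega> \<in> space M. Q n (word (f n) \<omega>)}) sequentially"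
    then obtain N where "\<And>n. N \<le> n \<Longrightarrow> \<not> Q n (word (f n) \<omega>)" by (auto simp: eventually_sequentially)
    then have "{n. Q n (word (f n) \<omega>)} \<subseteq> {..<N}" by (auto simp: not_le[symmetric])
    then show "finite {n. Q n (word (f n) \<omega>)}" by (rule finite_subset) simp
  qed
qed

text \<open>If \<open>V\<close> occurred only finitely often, there would be a last occurrence, possibly at time \<open>0\<close>. For each
\<open>n\<close> the event that the last occurrence is at time \<open>n\<close> has probability at most the infimum of the
escape probabilities, which is \<open>0\<close>.\<close>

lemma AE_infinitely_often:
  assumes nil: "V []" and regen: "\<And>u w. V u \<Longrightarrow> V (u @ w) \<longleftrightarrow> V w"
    and div: "\<not> summable (\<lambda>n. Ew n (\<lambda>u. of_bool (V u)))"
  shows "AE \<omega> in M. infinite {n. 1 \<le> n \<and> V (word n \<omega>)}"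
proof -
  have "AE \<omega> in M. \<not> (V (word n \<omega>) \<and> (\<forall>i>n. \<not> V (word i \<omega>)))" for n
  proof -
    let ?E = "{\<omega> \<in> space M. V (word n \<omega>) \<and> (\<forall>i>n. \<not> V (word i \<omega>))}"
    have E: "?E \<in> events"
    proof -
      have "?E = {\<omega> \<in> space M. V (word n \<omega>)} \<inter> (\<Inter>i\<in>{n<..}. {\<omega> \<in> space M. \<not> V (word i \<omega>)})" by auto
      then show ?thesis using word_event by auto
    qed
    have le: "prob ?E \<le> escape V m" for m
    proof -
      have "prob ?E \<le> prob {\<omega> \<in> space M. V (take n (word (n + m) \<omega>)) \<and> (\<forall>i\<in>{n<..n + m}. \<not> V (take i (word (n + m) \<omega>)))}"
        by (rule finite_measure_mono[OF _ word_event[of "\<lambda>u. V (take n u) \<and> (\<forall>i\<in>{n<..n + m}. \<not> V (take i u))"]])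
          (auto simp: take_word)
      also have "\<dots> = Ew n (\<lambda>u. of_bool (V u)) * escape V m"
        unfolding prob_word[of "\<lambda>u. V (take n u) \<and> (\<forall>i\<in>{n<..n + m}. \<not> V (take i u))"] by (rule last_visit_prob[OF regen])
      also have "\<dots> \<le> 1 * escape V m"
      proof (rule mult_right_mono[OF _ escape_nonneg])
        have "Ew n (\<lambda>u. of_bool (V u)) \<le> Ew n (\<lambda>_. 1)" by (rule Ew_mono) auto
        then show "Ew n (\<lambda>u. of_bool (V u)) \<le> 1" by simp
      qed
      finally show ?thesis by simp
    qed
    have "prob ?E \<le> 0"
    proof (rule field_le_epsilon)
      fix e :: real assume "0 < e"
      then obtain m where "escape V m < e" using escape_arbitrarily_small[OF regen div] by blast
      then show "prob ?E \<le> 0 + e" using le[of m] by simp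
    qed
    then have "prob ?E = 0" using measure_nonneg[of M ?E] by linarith
    then show ?thesis using prob_eq_0[OF E] by (auto elim: AE_mp)
  qed
  then have "AE \<omega> in M. \<forall>n. \<not> (V (word n \<omega>) \<and> (\<forall>i>n. \<not> V (word i \<omega>)))"
    unfolding AE_all_countable by blast
  then show ?thesis
  proof (rule AE_mp, intro AE_I2 impI notI)
    fix \<omega> assume more: "\<forall>n. \<not> (V (word n \<omega>) \<and> (\<forall>i>n. \<not> V (word i \<omega>)))"
      and fin: "finite {n. 1 \<le> n \<and> V (word n \<omega>)}"
    let ?F = "insert 0 {n. 1 \<le> n \<and> V (word n \<omega>)}"
    have F: "finite ?F" using fin by simp
    have "Max ?F \<in> ?F" using F by (intro Max_in) auto
    then have "V (word (Max ?F) \<omega>)" using nil by (auto simp: word_def)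
    then obtain i where i: "Max ?F < i" "V (word i \<omega>)" using more by blast
    then have "i \<in> ?F" by simp
    then show False using Max_ge[OF F, of i] i by simp
  qed
qed

text \<open>The event that both sums vanish and all levels up to \<open>l\<close> are \<open>1\<close> is regenerative: after it, the path
continues as from time \<open>0\<close>. Its probabilities are not summable.\<close>

lemma AE_double_zero:
  assumes "1 \<le> k" "k < l"
  shows "AE \<omega> in M. infinite {n. n \<ge> 1 \<and> S (\<lambda>n. \<xi> n \<omega>) (int k) n = 0 \<and> S (\<lambda>n. \<xi> n \<omega>) (int l) n = 0}"
proof -
  let ?V = "\<lambda>u. run l one u = one \<and> ssum l k one u = 0 \<and> ssum l l one u = 0"
  have "AE \<omega> in M. infinite {n. 1 \<le> n \<and> ?V (word n \<omega>)}"
    by (rule AE_infinitely_often)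
      (use return_probability_not_summable[OF assms] in \<open>auto simp: run_append ssum_append\<close>)
  then show ?thesis
  proof (rule AE_mp, intro AE_I2 impI)
    fix \<omega> assume "infinite {n. 1 \<le> n \<and> ?V (word n \<omega>)}"
    moreover have "{n. 1 \<le> n \<and> ?V (word n \<omega>)}
      \<subseteq> {n. n \<ge> 1 \<and> S (\<lambda>n. \<xi> n \<omega>) (int k) n = 0 \<and> S (\<lambda>n. \<xi> n \<omega>) (int l) n = 0}"
      unfolding word_def using assms by (auto simp: ssum_word[of _ l "\<lambda>n. \<xi> n \<omega>"])
    ultimately show "infinite {n. n \<ge> 1 \<and> S (\<lambda>n. \<xi> n \<omega>) (int k) n = 0 \<and> S (\<lambda>n. \<xi> n \<omega>) (int l) n = 0}"
      using finite_subset by blast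
  qed
qed

lemma AE_triple_zero:
  assumes "1 \<le> a" "a < b" "b < c"
  shows "AE \<omega> in M. finite {n. \<forall>j\<in>{a, b, c}. S (\<lambda>n. \<xi> n \<omega>) (int j) n = 0}"
proof -
  have "summable (\<lambda>n. Ew n (\<lambda>u. of_bool (\<forall>j\<in>{a, b, c}. ssum c j one u = 0)))"
    using zero_prob_three_summable[of a b c c] assms unfolding zero_prob_def by simp
  then have "AE \<omega> in M. finite {n. \<forall>j\<in>{a, b, c}. ssum c j one (word n \<omega>) = 0}"
    by (rule AE_finitely_often)
  then show ?thesis
    unfolding word_def using assms by (simp add: ssum_word[of _ c "\<lambda>n. \<xi> n _"])
qed

lemma AE_finite_zeros_neg:
  assumes "p \<noteq> 1/2"
  shows "AE \<omega> in M. finite {n. S (\<lambda>n. \<xi> n \<omega>) (- int j) n = 0}"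
proof -
  have "AE \<omega> in M. finite {N. \<bar>S (seq (word (N ^ 2) \<omega>)) (- int j) (N ^ 2)\<bar> \<le> 2 * int N}"
    by (rule AE_finitely_often[OF near_zero_at_squares_summable[OF assms]])
  with AE_signs show ?thesis
  proof eventually_elim
    case (elim \<omega>)
    let ?x = "\<lambda>n. \<xi> n \<omega>"
    let ?F = "{N. \<bar>S ?x (- int j) (N ^ 2)\<bar> \<le> 2 * int N}"
    have "S (seq (word n \<omega>)) (- int j) n = S ?x (- int j) n" for n
      by (rule S_cong) (auto simp: word_def)
    with elim have F: "finite ?F" by simp
    have "{n. S ?x (- int j) n = 0} \<subseteq> (\<Union>N\<in>?F. {N ^ 2..(N + 1) ^ 2})"
    proof
      fix n assume "n \<in> {n. S ?x (- int j) n = 0}"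
      then have z: "S ?x (- int j) n = 0" by simp
      define N where "N = floor_sqrt n"
      have N: "N ^ 2 \<le> n" "n < (N + 1) ^ 2"
        unfolding N_def using Suc_floor_sqrt_power2_gt[of n] by auto
      then have "n - N ^ 2 \<le> 2 * N" by (simp add: power2_eq_square)
      moreover have "\<bar>S ?x (- int j) n - S ?x (- int j) (N ^ 2)\<bar> \<le> int (n - N ^ 2)"
        using elim(1) N(1) by (intro S_increment) auto
      ultimately have "\<bar>S ?x (- int j) (N ^ 2)\<bar> \<le> 2 * int N" using z by linarith
      then show "n \<in> (\<Union>N\<in>?F. {N ^ 2..(N + 1) ^ 2})" using N by force
    qed
    then show ?case using F by (rule finite_subset[OF _ finite_UN_I]) auto
  qed
qed

end

theorem theorem2p1:
  fixes M :: "'a measure" and \<xi> :: "nat \<Rightarrow> 'a \<Rightarrow> int" and p :: real and K :: nat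
  assumes "prob_space M"
    and "prob_space.indep_vars M (\<lambda>_. count_space UNIV) \<xi> {1..}"
    and "\<And>n. n \<ge> 1 \<Longrightarrow> measure M {\<omega> \<in> space M. \<xi> n \<omega> = 1} = p"
    and "\<And>n. n \<ge> 1 \<Longrightarrow> measure M {\<omega> \<in> space M. \<xi> n \<omega> = -1} = 1 - p"
    and "0 < p" and "p < 1"
    and "K \<ge> 1"
  shows "AE \<omega> in M. let S' = S (\<lambda>n. \<xi> n \<omega>) in
      ((p \<noteq> 1/2 \<longrightarrow> (\<forall>k\<in>{- int K..0}. finite {n. n \<ge> 1 \<and> S' k n = 0})) \<and>
       (\<forall>k\<in>{1..int K}. infinite {n. n \<ge> 1 \<and> S' k n = 0})) \<and>
      (\<forall>k\<in>{1..int K}. \<forall>l\<in>{1..int K}. infinite {n. n \<ge> 1 \<and> (S' k n, S' l n) = (0, 0)}) \<and>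
      (\<forall>d::nat. 3 \<le> d \<and> d \<le> K \<longrightarrow>
        (\<forall>\<kappa>::nat \<Rightarrow> int. inj_on \<kappa> {1..d} \<and> \<kappa> ` {1..d} \<subseteq> {1..int K} \<longrightarrow>
          finite {n. n \<ge> 1 \<and> (\<forall>i\<in>{1..d}. S' (\<kappa> i) n = 0)}))"
proof -
  interpret prob_space M by fact
  interpret sign_process p M \<xi>
    by unfold_locales (use assms in auto)
  have neg: "AE \<omega> in M. \<forall>j. p \<noteq> 1/2 \<longrightarrow> finite {n. S (\<lambda>n. \<xi> n \<omega>) (- int j) n = 0}"
    unfolding AE_all_countable by (intro allI AE_impI AE_finite_zeros_neg)
  have two: "AE \<omega> in M. \<forall>k l. 1 \<le> k \<longrightarrow> k < l \<longrightarrow>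
      infinite {n. n \<ge> 1 \<and> S (\<lambda>n. \<xi> n \<omega>) (int k) n = 0 \<and> S (\<lambda>n. \<xi> n \<omega>) (int l) n = 0}"
    unfolding AE_all_countable by (intro allI AE_impI AE_double_zero)
  have three: "AE \<omega> in M. \<forall>a b c. 1 \<le> a \<longrightarrow> a < b \<longrightarrow> b < c \<longrightarrow>
      finite {n. \<forall>j\<in>{a, b, c}. S (\<lambda>n. \<xi> n \<omega>) (int j) n = 0}"
    unfolding AE_all_countable by (intro allI AE_impI AE_triple_zero)
  from neg two three show ?thesis
  proof eventually_elim
    case (elim \<omega>)
    define S' where "S' = S (\<lambda>n. \<xi> n \<omega>)"
    have low: "finite {n. n \<ge> 1 \<and> S' k n = 0}" if "p \<noteq> 1/2" "k \<in> {- int K..0}" for k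
    proof -
      have "finite {n. S' k n = 0}"
        using elim(1)[rule_format, of "nat (- k)"] that by (simp add: S'_def)
      then show ?thesis by (rule finite_subset[rotated]) auto
    qed
    have pair: "infinite {n. n \<ge> 1 \<and> S' k n = 0 \<and> S' l n = 0}" if "1 \<le> k" "k < l" for k l
      using elim(2)[rule_format, of "nat k" "nat l"] that by (simp add: S'_def)
    have both: "infinite {n. n \<ge> 1 \<and> (S' k n, S' l n) = (0, 0)}" if "k \<in> {1..int K}" "l \<in> {1..int K}" for k l
    proof -
      consider "k < l" | "l < k" | "k = l" by linarith
      then show ?thesis
      proof cases
        case 1 then show ?thesis using pair[of k l] that by simp
      next
        case 2 then show ?thesis using pair[of l k] that by (simp add: conj_commute)
      next
        case 3
        (* Level k + 1 may exceed K; the array is defined at all levels. *)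
        have "infinite {n. n \<ge> 1 \<and> S' k n = 0 \<and> S' (k + 1) n = 0}" using pair[of k "k + 1"] that by simp
        moreover have "{n. n \<ge> 1 \<and> S' k n = 0 \<and> S' (k + 1) n = 0} \<subseteq> {n. n \<ge> 1 \<and> (S' k n, S' l n) = (0, 0)}"
          using 3 by auto
        ultimately show ?thesis using finite_subset by blast
      qed
    qed
    have single: "infinite {n. n \<ge> 1 \<and> S' k n = 0}" if "k \<in> {1..int K}" for k
      using both[OF that that] by simp
    have many: "finite {n. n \<ge> 1 \<and> (\<forall>i\<in>{1..d}. S' (\<kappa> i) n = 0)}"
      if d: "3 \<le> d" and \<kappa>: "inj_on \<kappa> {1..d}" "\<kappa> ` {1..d} \<subseteq> {1..int K}" for d :: nat and \<kappa> :: "nat \<Rightarrow> int"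
    proof -
      (* Three of the d levels suffice; they are sorted increasingly. *)
      let ?A = "(\<lambda>i. nat (\<kappa> i)) ` {1, 2, 3}"
      have pos: "1 \<le> \<kappa> i" if "i \<in> {1..d}" for i using \<kappa>(2) that by force
      have "inj_on (\<lambda>i. nat (\<kappa> i)) {1, 2, 3}"
      proof (rule inj_onI)
        fix i j :: nat assume *: "i \<in> {1, 2, 3}" "j \<in> {1, 2, 3}" "nat (\<kappa> i) = nat (\<kappa> j)"
        then have ij: "i \<in> {1..d}" "j \<in> {1..d}" using d by auto
        then have "\<kappa> i = \<kappa> j" using pos[of i] pos[of j] * by simp
        then show "i = j" using \<kappa>(1) ij by (auto dest: inj_onD)
      qed
      then have "card ?A = 3" by (simp add: card_image)
      obtain a b c where abc: "?A = {a, b, c}" "a < b" "b < c"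
      proof -
        define xs where "xs = sorted_list_of_set ?A"
        have "length xs = 3" using \<open>card ?A = 3\<close> unfolding xs_def by (simp only: length_sorted_list_of_set)
        then obtain a b c where xs: "xs = [a, b, c]" by (auto simp: length_Suc_conv numeral_3_eq_3)
        have "sorted_wrt (<) xs" unfolding xs_def by (rule strict_sorted_list_of_set)
        moreover have "set xs = ?A" unfolding xs_def by (rule set_sorted_list_of_set) simp
        ultimately show ?thesis using that[of a b c] unfolding xs by simp
      qed
      have "1 \<le> a"
      proof -
        have "a \<in> ?A" using abc by simp
        then obtain i where "i \<in> {1, 2, 3}" "a = nat (\<kappa> i)" by blast
        then show ?thesis using pos[of i] d by auto
      qed
      then have fin: "finite {n. \<forall>j\<in>{a, b, c}. S' (int j) n = 0}" 
        using elim(3)[rule_format, of a b c] abc(2,3) unfolding S'_def by blast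
      show ?thesis
      proof (rule finite_subset[OF _ fin], rule subsetI, rule CollectI, rule ballI)
        fix n j assume n: "n \<in> {n. n \<ge> 1 \<and> (\<forall>i\<in>{1..d}. S' (\<kappa> i) n = 0)}" and j: "j \<in> {a, b, c}"
        have "j \<in> ?A" using j abc(1) by simp
        then obtain i where i: "i \<in> {1, 2, 3}" "j = nat (\<kappa> i)" by blast
        then have "i \<in> {1..d}" using d by auto
        then show "S' (int j) n = 0" using n i pos[of i] by auto
      qed
    qed
    show ?case
      unfolding Let_def S'_def[symmetric]
      by (intro conjI impI ballI allI; (elim conjE)?; (rule low | rule single | rule both | rule many); assumption)
  qed
qed

end
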